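(* Let $S=\mathfrak v\oplus\mathfrak z\times\mathbb R_+$ be the half-space model of an arbitrary Damek--Ricci space, $n=\dim\mathfrak v$, let $\mathfrak v=\mathfrak v_1\oplus\mathfrak v_2$ be a decomposition of $\mathfrak v$ into the direct sum of two orthogonal linear subspaces, with orthogonal projections $\Pi_i\colon\mathfrak v\to\mathfrak v_i$ ($i=1,2$), and consider the function $F\colon S\to\mathbb R$, $$F(v,z,t)=\frac{\left(t+\frac12\|\Pi_2v\|^2\right)^2+\left\|z-\frac12[\Pi_1v,\Pi_2v]\right\|^2}{t^2}.$$ (i) $F$ is transnormal if and only if $J_{\mathfrak z}\mathfrak v_1\subseteq\mathfrak v_2$ and $J_{\mathfrak z}\mathfrak v_2\subseteq\mathfrak v_1$ (i.e. $J_zv_1\in\mathfrak v_2$ and $J_zv_2\in\mathfrak v_1$ for all $z\in\mathfrak z$, $v_1\in\mathfrak v_1$, $v_2\in\mathfrak v_2$). (ii) $F$ is isoparametric if and only if the Damek--Ricci space is the complex hyperbolic space $\mathbb C\mathbf H^k$ with $n=2(k-1)$ and $\mathfrak v_1$ is a maximal totally real subspace of $\mathfrak v=\mathbb C^{k-1}$.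
   Context: Damek--Ricci data: $\mathfrak v,\mathfrak z$ are finite-dimensional real Euclidean vector spaces, and $J\colon\mathfrak z\to\mathrm{End}(\mathfrak v)$, $z\mapsto J_z$, is the linear map underlying a representation on $\mathfrak v$ of the Clifford algebra $\mathrm{Cl}(\mathfrak z,q)$, $q(z)=-\langle z,z\rangle$ (so $J_z^2=-\|z\|^2\mathrm{Id}$), such that $\|J_zv\|=\|z\|\|v\|$ for all $z,v$. The skew-symmetric bilinear map $[\cdot,\cdot]\colon\mathfrak v\times\mathfrak v\to\mathfrak z$ is defined by $\langle[v_1,v_2],z\rangle=\langle J_zv_1,v_2\rangle$ for all $z\in\mathfrak z$. The half-space model of the Damek--Ricci space is $S=\mathfrak v\oplus\mathfrak z\times\mathbb R_+=\{(v,z,t): t>0\}$ with the Riemannian metric $$\langle(v_1,z_1,t_1),(v_2,z_2,t_2)\rangle_{(\bar v,\bar z,\bar t)}=\tfrac1{\bar t}\langle v_1,v_2\rangle+\tfrac1{\bar t^2}\left\langle z_1+\tfrac12[v_1,\bar v],z_2+\tfrac12[v_2,\bar v]\right\rangle+\tfrac{t_1t_2}{\bar t^2}.$$ The complex hyperbolic space $\mathbb C\mathbf H^k$ is the Damek--Ricci space with $\dim\mathfrak z=1$ and $n=2(k-1)$; for a unit vector $e\in\mathfrak z$, $J_e$ is a complex structure identifying $\mathfrak v$ with $\mathbb C^{k-1}$. A maximal totally real subspace of $\mathfrak v=\mathbb C^{k-1}$ is a real linear subspace $\mathfrak v_1$ of real dimension $k-1$ such that $J_e\mathfrak v_1$ is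 orthogonal to $\mathfrak v_1$. A smooth function $F\colon M\to\mathbb R$ on a Riemannian manifold is transnormal if $\|\nabla F\|^2=b\circ F$ for some $\mathcal C^2$ function $b\colon\mathrm{im}\,F\to\mathbb R$; it is isoparametric if in addition $\Delta F=a\circ F$ for some continuous function $a\colon\mathrm{im}\,F\to\mathbb R$.
   Formalization: The formal statement takes both 𝔳 and 𝔷 to be nonzero; if 𝔷 = 0 (real hyperbolic space), or if 𝔳 = 0 and dim 𝔷 ≥ 2, F is isoparametric although the space is not complex hyperbolic as in (ii), so (ii) fails there. *)

theory Defs
  imports "HOL-Analysis.Analysis"
begin

section \<open>Smooth functions and Riemannian geometry on an open subset of a Euclidean space\<close>

text \<open>
  On an open set this is the usual notion of a function of class \<open>C\<^sup>k\<close>: all iterated directional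
  derivatives up to order \<open>k\<close> exist as total derivatives and are continuous.  On an interval of
  the real line with end points, the derivatives at the end points are one-sided.
\<close>

primrec Ck_on :: "nat \<Rightarrow> 'a::euclidean_space set \<Rightarrow> ('a \<Rightarrow> real) \<Rightarrow> bool" where
  "Ck_on 0 S f \<longleftrightarrow> continuous_on S f"
| "Ck_on (Suc k) S f \<longleftrightarrow>
     (\<exists>f'. (\<forall>x\<in>S. (f has_derivative f' x) (at x within S)) \<and> (\<forall>u. Ck_on k S (\<lambda>x. f' x u)))"

definition smooth_on :: "'a::euclidean_space set \<Rightarrow> ('a \<Rightarrow> real) \<Rightarrow> bool" where
  "smooth_on S f \<longleftrightarrow> (\<forall>k. Ck_on k S f)"

text \<open>
  A Riemannian manifold is given by an open subset \<open>M\<close> of a Euclidean space \<open>'a\<close> and a metric \<open>g\<close>: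
  \<open>g p\<close> is the inner product on the tangent space \<open>'a\<close> at \<open>p \<in> M\<close>.  The inner product of \<open>'a\<close>
  itself plays no geometric role; it is used below only to express the trace of an endomorphism.
\<close>

type_synonym 'a metric_tensor = "'a \<Rightarrow> 'a \<Rightarrow> 'a \<Rightarrow> real"

definition riem_gradient ::
    "'a::euclidean_space metric_tensor \<Rightarrow> ('a \<Rightarrow> real) \<Rightarrow> 'a \<Rightarrow> 'a" where
  "riem_gradient g F p = (THE X. \<forall>Y. g p X Y = frechet_derivative F (at p) Y)"

text \<open>
  The Christoffel map: the Levi-Civita derivative at \<open>p\<close> of the constant vector field \<open>X\<close> in
  direction \<open>Y\<close>, as determined by the Koszul formula (constant fields commute).
\<close>

definition christoffel :: "'a::euclidean_space metric_tensor \<Rightarrow> 'a \<Rightarrow> 'a \<Rightarrow> 'a \<Rightarrow> 'a" where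
  "christoffel g p Y X = (THE C. \<forall>Z. 2 * g p C Z =
      frechet_derivative (\<lambda>q. g q X Z) (at p) Y
    + frechet_derivative (\<lambda>q. g q Y Z) (at p) X
    - frechet_derivative (\<lambda>q. g q X Y) (at p) Z)"

definition levi_civita ::
    "'a::euclidean_space metric_tensor \<Rightarrow> 'a \<Rightarrow> ('a \<Rightarrow> 'a) \<Rightarrow> 'a \<Rightarrow> 'a" where
  "levi_civita g Y V p = frechet_derivative V (at p) Y + christoffel g p Y (V p)"

text \<open>The divergence of \<open>V\<close> is the trace of the endomorphism mapping \<open>Y\<close> to the derivative of \<open>V\<close>
  in direction \<open>Y\<close>.\<close>

definition riem_divergence ::
    "'a::euclidean_space metric_tensor \<Rightarrow> ('a \<Rightarrow> 'a) \<Rightarrow> 'a \<Rightarrow> real" where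
  "riem_divergence g V p = (\<Sum>b\<in>Basis. levi_civita g b V p \<bullet> b)"

definition riem_laplacian ::
    "'a::euclidean_space metric_tensor \<Rightarrow> ('a \<Rightarrow> real) \<Rightarrow> 'a \<Rightarrow> real" where
  "riem_laplacian g F = riem_divergence g (riem_gradient g F)"

definition transnormal ::
    "'a::euclidean_space set \<Rightarrow> 'a metric_tensor \<Rightarrow> ('a \<Rightarrow> real) \<Rightarrow> bool" where
  "transnormal M g F \<longleftrightarrow> smooth_on M F \<and>
     (\<exists>b. Ck_on 2 (F ` M) b \<and>
          (\<forall>p\<in>M. g p (riem_gradient g F p) (riem_gradient g F p) = b (F p)))"

definition isoparametric ::
    "'a::euclidean_space set \<Rightarrow> 'a metric_tensor \<Rightarrow> ('a \<Rightarrow> real) \<Rightarrow> bool" where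
  "isoparametric M g F \<longleftrightarrow> transnormal M g F \<and>
     (\<exists>a. continuous_on (F ` M) a \<and> (\<forall>p\<in>M. riem_laplacian g F p = a (F p)))"

section \<open>Damek--Ricci spaces\<close>

text \<open>
  The spaces \<open>\<vv>\<close> and \<open>\<zz>\<close> are the types \<open>'v\<close> and \<open>'z\<close>; the class \<open>euclidean_space\<close> makes
  both of them nonzero.  By the universal property of the Clifford algebra, its representations
  on \<open>\<vv>\<close> are exactly the linear maps \<open>J\<close> with \<open>J z (J z v) = - \<parallel>z\<parallel>\<^sup>2 v\<close>.
\<close>

locale damek_ricci =
  fixes J :: "'z::euclidean_space \<Rightarrow> 'v::euclidean_space \<Rightarrow> 'v"
  assumes J_bilinear: "bilinear J"
    and J_clifford: "J z (J z v) = - ((norm z)\<^sup>2 *\<^sub>R v)"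
    and J_norm: "norm (J z v) = norm z * norm v"

definition bracket ::
    "('z::euclidean_space \<Rightarrow> 'v::euclidean_space \<Rightarrow> 'v) \<Rightarrow> 'v \<Rightarrow> 'v \<Rightarrow> 'z" where
  "bracket J v w = (THE u. \<forall>z. u \<bullet> z = J z v \<bullet> w)"

lemma (in damek_ricci) bracket_inner: "bracket J v w \<bullet> z = J z v \<bullet> w"
proof -
  have lin: "linear (\<lambda>z. J z v \<bullet> w)"
    by (rule linearI)
      (simp_all add: bilinear_ladd[OF J_bilinear] bilinear_lmul[OF J_bilinear] inner_add_left)
  define u where "u = (\<Sum>b\<in>Basis. (J b v \<bullet> w) *\<^sub>R b)"
  have u: "u \<bullet> x = J x v \<bullet> w" for x
  proof -
    have "J x v \<bullet> w = J (\<Sum>b\<in>Basis. (x \<bullet> b) *\<^sub>R b) v \<bullet> w"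
      by (simp add: euclidean_representation)
    also have "\<dots> = (\<Sum>b\<in>Basis. (x \<bullet> b) * (J b v \<bullet> w))"
      using linear_sum[OF lin, of "\<lambda>b. (x \<bullet> b) *\<^sub>R b" Basis]
      by (simp add: bilinear_lmul[OF J_bilinear])
    also have "\<dots> = u \<bullet> x"
      unfolding u_def inner_sum_left
      by (intro sum.cong refl) (simp add: inner_commute mult.commute)
    finally show ?thesis by simp
  qed
  have "\<forall>x. bracket J v w \<bullet> x = J x v \<bullet> w"
    unfolding bracket_def
  proof (rule theI[where a = u])
    fix u' assume "\<forall>x. u' \<bullet> x = J x v \<bullet> w"
    then have "\<forall>x. u' \<bullet> x = u \<bullet> x" using u by simp
    then show "u' = u" by (simp only: vector_eq_rdot)
  qed (use u in simp)
  then show ?thesis ..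
qed

definition half_space :: "('v::euclidean_space \<times> 'z::euclidean_space \<times> real) set" where
  "half_space = {(v, z, t). t > 0}"

definition dr_metric ::
    "('z::euclidean_space \<Rightarrow> 'v::euclidean_space \<Rightarrow> 'v) \<Rightarrow> ('v \<times> 'z \<times> real) metric_tensor" where
  "dr_metric J = (\<lambda>(v, z, t) (v1, z1, t1) (v2, z2, t2).
     (1 / t) * (v1 \<bullet> v2)
     + (1 / t\<^sup>2) * ((z1 + (1/2) *\<^sub>R bracket J v1 v) \<bullet> (z2 + (1/2) *\<^sub>R bracket J v2 v))
     + (t1 * t2) / t\<^sup>2)"

text \<open>The orthogonal projection onto the subspace \<open>V\<close>.\<close>

definition orth_proj :: "'v::euclidean_space set \<Rightarrow> 'v \<Rightarrow> 'v" where
  "orth_proj V v = (THE x. x \<in> V \<and> (\<forall>y\<in>V. orthogonal (v - x) y))"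

lemma orth_proj:
  assumes "subspace V"
  shows "orth_proj V v \<in> V" and "y \<in> V \<Longrightarrow> orthogonal (v - orth_proj V v) y"
proof -
  have sp: "span V = V" using assms by (simp add: span_eq_iff)
  obtain x w where x: "x \<in> V" and w: "\<And>y. y \<in> V \<Longrightarrow> orthogonal w y" and v: "v = x + w"
    using orthogonal_subspace_decomp_exists[of V v] unfolding sp by blast
  have "orth_proj V v \<in> V \<and> (\<forall>y\<in>V. orthogonal (v - orth_proj V v) y)"
    unfolding orth_proj_def
  proof (rule theI[where a = x])
    show "x \<in> V \<and> (\<forall>y\<in>V. orthogonal (v - x) y)" using x w v by simp
    fix x' assume x': "x' \<in> V \<and> (\<forall>y\<in>V. orthogonal (v - x') y)"
    then have "x' - x \<in> V" using x assms by (simp add: subspace_diff)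
    then have "orthogonal (v - x') (x' - x)" "orthogonal w (x' - x)" using x' w by auto
    then have "(x' - x) \<bullet> (x' - x) = 0"
      unfolding orthogonal_def v by (simp add: inner_diff inner_add)
    then show "x' = x" by simp
  qed
  then show "orth_proj V v \<in> V" and "y \<in> V \<Longrightarrow> orthogonal (v - orth_proj V v) y" by auto
qed

definition dr_function ::
    "('z::euclidean_space \<Rightarrow> 'v::euclidean_space \<Rightarrow> 'v) \<Rightarrow> 'v set \<Rightarrow> 'v set
      \<Rightarrow> 'v \<times> 'z \<times> real \<Rightarrow> real" where
  "dr_function J V1 V2 = (\<lambda>(v, z, t).
     ((t + (1/2) * (norm (orth_proj V2 v))\<^sup>2)\<^sup>2
      + (norm (z - (1/2) *\<^sub>R bracket J (orth_proj V1 v) (orth_proj V2 v)))\<^sup>2) / t\<^sup>2)"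

definition complex_hyperbolic ::
    "('z::euclidean_space \<Rightarrow> 'v::euclidean_space \<Rightarrow> 'v) \<Rightarrow> nat \<Rightarrow> bool" where
  "complex_hyperbolic J k \<longleftrightarrow>
     damek_ricci J \<and> DIM('z) = 1 \<and> k \<ge> 1 \<and> DIM('v) = 2 * (k - 1)"

text \<open>
  For \<open>dim \<zz> = 1\<close> there are exactly two unit vectors \<open>e\<close>, differing by a sign, so that the condition
  does not depend on the choice of \<open>e\<close>.
\<close>

definition maximal_totally_real ::
    "('z::euclidean_space \<Rightarrow> 'v::euclidean_space \<Rightarrow> 'v) \<Rightarrow> nat \<Rightarrow> 'v set \<Rightarrow> bool" where
  "maximal_totally_real J k V \<longleftrightarrow> subspace V \<and> dim V = k - 1 \<and>
     (\<forall>e. norm e = 1 \<longrightarrow> (\<forall>x\<in>V. \<forall>y\<in>V. orthogonal (J e x) y))"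

end

theory Submission
  imports Defs
begin

text \<open>
  Write \<open>x = \<Pi>\<^sub>1 v\<close>, \<open>y = \<Pi>\<^sub>2 v\<close>, \<open>A = t + \<parallel>y\<parallel>\<^sup>2/2\<close> (the height) and \<open>w = z - [x, y]/2\<close> (the center), so that
  \<open>F = (A\<^sup>2 + \<parallel>w\<parallel>\<^sup>2)/t\<^sup>2\<close>.  The squared norm of the gradient of \<open>F\<close> is \<open>4 F (F - 1)\<close> plus a defect built from
  the components \<open>\<Pi>\<^sub>1 J\<^sub>w y\<close>, \<open>\<Pi>\<^sub>2 J\<^sub>w y\<close>, \<open>\<Pi>\<^sub>1 J\<^sub>w x\<close>.  The defect vanishes at the points \<open>(0, z, 1)\<close>, where \<open>F\<close>
  already takes all its values; hence \<open>F\<close> is transnormal iff the defect vanishes everywhere.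
  In that case the gradient is \<open>(2/t) (A y + J\<^sub>w y, A z, A t - A\<^sup>2 - \<parallel>w\<parallel>\<^sup>2)\<close> and
  \<open>\<Delta>F = 2 (dim \<zz> - 1) A/t + (n + 2 dim \<zz> + 4) F - 2 - 2 dim \<zz>\<close>, which is a function of \<open>F\<close> iff \<open>dim \<zz> = 1\<close>.
\<close>

section \<open>Functions of class \<open>C\<^sup>k\<close>\<close>

lemma Ck_on_Suc_imp_Ck_on: "Ck_on (Suc k) S f \<Longrightarrow> Ck_on k S f"
proof (induction k arbitrary: f)
  case 0
  then show ?case
    by (auto intro: has_derivative_continuous_on)
next
  case (Suc k)
  then show ?case by (metis Ck_on.simps(2))
qed

lemma Ck_on_const: "Ck_on k S (\<lambda>x. c)"
proof (induction k arbitrary: c)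
  case (Suc k)
  have "((\<lambda>x. c) has_derivative (\<lambda>u. 0)) (at x within S)" for x
    by simp
  with Suc show ?case
    by (auto intro!: exI[of _ "\<lambda>x u. 0"])
qed simp

lemma Ck_on_linear:
  assumes "linear f"
  shows "Ck_on k S f"
proof (cases k)
  case 0
  then show ?thesis using assms by (simp add: linear_continuous_on linear_conv_bounded_linear)
next
  case (Suc l)
  have "(f has_derivative f) (at x within S)" for x
    using assms by (simp add: bounded_linear_imp_has_derivative linear_conv_bounded_linear)
  then show ?thesis using Ck_on_const unfolding Suc
    by (auto intro!: exI[of _ "\<lambda>x. f"])
qed

lemma Ck_on_add: "Ck_on k S f \<Longrightarrow> Ck_on k S g \<Longrightarrow> Ck_on k S (\<lambda>x. f x + g x)"
proof (induction k arbitrary: f g)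
  case 0
  then show ?case by (simp add: continuous_on_add)
next
  case (Suc k)
  obtain f' g' where f': "\<forall>x\<in>S. (f has_derivative f' x) (at x within S)" "\<forall>u. Ck_on k S (\<lambda>x. f' x u)"
    and g': "\<forall>x\<in>S. (g has_derivative g' x) (at x within S)" "\<forall>u. Ck_on k S (\<lambda>x. g' x u)"
    using Suc.prems by auto
  have "((\<lambda>x. f x + g x) has_derivative (\<lambda>u. f' x u + g' x u)) (at x within S)" if "x \<in> S" for x
    using f' g' that by (auto intro: has_derivative_add)
  with f' g' Suc.IH show ?case
    by (auto intro!: exI[of _ "\<lambda>x u. f' x u + g' x u"])
qed

lemma Ck_on_mult: "Ck_on k S f \<Longrightarrow> Ck_on k S g \<Longrightarrow> Ck_on k S (\<lambda>x. f x * g x)"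
proof (induction k arbitrary: f g)
  case 0
  then show ?case by (simp add: continuous_on_mult)
next
  case (Suc k)
  obtain f' g' where f': "\<forall>x\<in>S. (f has_derivative f' x) (at x within S)" "\<forall>u. Ck_on k S (\<lambda>x. f' x u)"
    and g': "\<forall>x\<in>S. (g has_derivative g' x) (at x within S)" "\<forall>u. Ck_on k S (\<lambda>x. g' x u)"
    using Suc.prems by auto
  have "((\<lambda>x. f x * g x) has_derivative (\<lambda>u. f x * g' x u + f' x u * g x)) (at x within S)"
    if "x \<in> S" for x
    using f' g' that by (auto intro: has_derivative_mult)
  moreover have "Ck_on k S (\<lambda>x. f x * g' x u + f' x u * g x)" for u
    using f' g' Suc.prems by (intro Ck_on_add Suc.IH) (auto simp only: Ck_on_Suc_imp_Ck_on)
  ultimately show ?case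
    unfolding Ck_on.simps by (intro exI[of _ "\<lambda>x u. f x * g' x u + f' x u * g x"]) simp
qed

lemma Ck_on_diff:
  assumes "Ck_on k S f" "Ck_on k S g"
  shows "Ck_on k S (\<lambda>x. f x - g x)"
  using Ck_on_add[OF assms(1) Ck_on_mult[OF Ck_on_const[of k S "-1"] assms(2)]] by simp

lemma Ck_on_sum:
  assumes "\<And>i. i \<in> I \<Longrightarrow> Ck_on k S (f i)"
  shows "Ck_on k S (\<lambda>x. \<Sum>i\<in>I. f i x)"
  using assms
  by (induction I rule: infinite_finite_induct) (auto simp: Ck_on_const intro: Ck_on_add)

lemma Ck_on_power: "Ck_on k S f \<Longrightarrow> Ck_on k S (\<lambda>x. f x ^ n)"
  by (induction n) (auto simp: Ck_on_const intro: Ck_on_mult)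

text \<open>\<open>Ck_on\<close> speaks about real-valued functions only, so vector-valued maps
  enter through their components.\<close>

lemma Ck_on_inner:
  fixes f g :: "'a::euclidean_space \<Rightarrow> 'b::euclidean_space"
  assumes "\<And>b. b \<in> Basis \<Longrightarrow> Ck_on k S (\<lambda>x. f x \<bullet> b)" "\<And>b. b \<in> Basis \<Longrightarrow> Ck_on k S (\<lambda>x. g x \<bullet> b)"
  shows "Ck_on k S (\<lambda>x. f x \<bullet> g x)"
  using assms by (subst euclidean_inner) (intro Ck_on_sum Ck_on_mult)

lemma Ck_on_inverse:
  "Ck_on k S f \<Longrightarrow> (\<And>x. x \<in> S \<Longrightarrow> f x \<noteq> 0) \<Longrightarrow> Ck_on k S (\<lambda>x. inverse (f x))"
proof (induction k arbitrary: f)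
  case 0
  then show ?case by (simp add: continuous_on_inverse)
next
  case (Suc k)
  obtain f' where f': "\<forall>x\<in>S. (f has_derivative f' x) (at x within S)" "\<forall>u. Ck_on k S (\<lambda>x. f' x u)"
    using Suc.prems by auto
  \<comment> \<open>The derivative contains \<open>inverse (f x)\<close> again, now needed only to
    order \<open>k\<close>, which is what the induction hypothesis provides. The factor
    \<open>- 1\<close> turns the sign into a product with a constant.\<close>
  define d where "d = (\<lambda>x u. - 1 * (inverse (f x) * f' x u * inverse (f x)))"
  have "((\<lambda>x. inverse (f x)) has_derivative d x) (at x within S)" if "x \<in> S" for x
    unfolding d_def using f' that Suc.prems by (auto intro!: derivative_eq_intros)
  moreover have "Ck_on k S (\<lambda>x. d x u)" for u
    using f' Suc.prems unfolding d_def
    by (intro Ck_on_mult Ck_on_const Suc.IH) (auto simp only: Ck_on_Suc_imp_Ck_on)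
  ultimately show ?case
    unfolding Ck_on.simps by (intro exI[of _ d]) simp
qed

section \<open>Traces\<close>

lemma sum_Basis_prod:
  fixes f :: "'a::euclidean_space \<times> 'b::euclidean_space \<Rightarrow> 'c::comm_monoid_add"
  shows "(\<Sum>b\<in>Basis. f b) = (\<Sum>e\<in>Basis. f (e, 0)) + (\<Sum>e\<in>Basis. f (0, e))"
  unfolding Basis_prod_def
  by (subst sum.union_disjoint)
    (auto simp: sum.reindex inj_on_def)

lemma linear_eq_inner:
  fixes \<phi> :: "'a::euclidean_space \<Rightarrow> real"
  assumes "linear \<phi>"
  obtains a where "\<And>x. \<phi> x = a \<bullet> x"
proof
  show "\<phi> x = adjoint \<phi> 1 \<bullet> x" for x
    using adjoint_clauses(2)[OF assms, of 1 x] by simp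
qed

text \<open>In the standard bases both traces are the same double sum of products of matrix
  entries.\<close>

lemma trace_cyclic:
  fixes f :: "'a::euclidean_space \<Rightarrow> 'b::euclidean_space" and g :: "'b \<Rightarrow> 'a"
  assumes "linear f" "linear g"
  shows "(\<Sum>b\<in>Basis. g (f b) \<bullet> b) = (\<Sum>c\<in>Basis. f (g c) \<bullet> c)"
proof -
  have "(\<Sum>b\<in>Basis. g (f b) \<bullet> b) = (\<Sum>b\<in>Basis. f b \<bullet> adjoint g b)"
    using assms by (simp add: adjoint_clauses)
  also have "\<dots> = (\<Sum>b\<in>Basis. \<Sum>c\<in>Basis. (f b \<bullet> c) * (g c \<bullet> b))"
    using assms by (subst euclidean_inner) (simp add: adjoint_clauses inner_commute)
  also have "\<dots> = (\<Sum>c\<in>Basis. \<Sum>b\<in>Basis. (g c \<bullet> b) * (f b \<bullet> c))"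
    by (subst sum.swap) (simp add: mult.commute)
  also have "\<dots> = (\<Sum>c\<in>Basis. g c \<bullet> adjoint f c)"
    using assms by (subst (2) euclidean_inner) (simp add: adjoint_clauses inner_commute)
  also have "\<dots> = (\<Sum>c\<in>Basis. f (g c) \<bullet> c)"
    using assms by (simp add: adjoint_clauses)
  finally show ?thesis .
qed

text \<open>The matrix of \<open>S\<close> is symmetric, so expanding \<open>S b\<close> in the
  basis gives the same double sum on both sides. With \<open>S = sharp p\<close> this cancels two of
  the three Koszul terms in a trace.\<close>

lemma sum_bilinear_selfadjoint:
  fixes B :: "'a::euclidean_space \<Rightarrow> 'a \<Rightarrow> real"
  assumes B: "bilinear B" and S: "\<And>x y. S x \<bullet> y = x \<bullet> S y"
  shows "(\<Sum>b\<in>Basis. B b (S b)) = (\<Sum>b\<in>Basis. B (S b) b)"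
proof -
  have l: "linear (B x)" "linear (\<lambda>x. B x y)" for x y
    using B by (auto simp: bilinear_def)
  have "(\<Sum>b\<in>Basis. B b (S b)) = (\<Sum>b\<in>Basis. B b (\<Sum>c\<in>Basis. (S b \<bullet> c) *\<^sub>R c))"
    by (simp add: euclidean_representation)
  also have "\<dots> = (\<Sum>b\<in>Basis. \<Sum>c\<in>Basis. (S b \<bullet> c) * B b c)"
    by (simp add: linear_sum[OF l(1)] linear_cmul[OF l(1)])
  also have "\<dots> = (\<Sum>c\<in>Basis. \<Sum>b\<in>Basis. (S c \<bullet> b) * B b c)"
    using S by (subst sum.swap) (simp add: inner_commute[of "S _"])
  also have "\<dots> = (\<Sum>c\<in>Basis. B (\<Sum>b\<in>Basis. (S c \<bullet> b) *\<^sub>R b) c)"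
    by (simp add: linear_sum[OF l(2)] linear_cmul[OF l(2)])
  finally show ?thesis by (simp add: euclidean_representation)
qed

section \<open>The geometry of Damek--Ricci spaces\<close>

context damek_ricci
begin

section \<open>Algebra of the Clifford map and of the bracket\<close>

lemma bounded_bilinear_J: "bounded_bilinear J"
  using J_bilinear bilinear_conv_bounded_bilinear by blast

lemmas J_simps =
  bounded_bilinear.add_left[OF bounded_bilinear_J] bounded_bilinear.add_right[OF bounded_bilinear_J]
  bounded_bilinear.diff_left[OF bounded_bilinear_J] bounded_bilinear.diff_right[OF bounded_bilinear_J]
  bounded_bilinear.scaleR_left[OF bounded_bilinear_J] bounded_bilinear.scaleR_right[OF bounded_bilinear_J]
  bounded_bilinear.minus_left[OF bounded_bilinear_J] bounded_bilinear.minus_right[OF bounded_bilinear_J]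
  bounded_bilinear.zero_left[OF bounded_bilinear_J] bounded_bilinear.zero_right[OF bounded_bilinear_J]

lemma linear_J: "linear (J z)"
  using J_bilinear by (simp add: bilinear_def)

text \<open>The norm identity \<open>J_norm\<close>, polarized in the vector on which
  \<open>J z\<close> acts.\<close>

lemma J_inner_J: "J z u \<bullet> J z v = (z \<bullet> z) * (u \<bullet> v)"
proof -
  have "J z u \<bullet> J z v = ((norm (J z (u + v)))\<^sup>2 - (norm (J z u))\<^sup>2 - (norm (J z v))\<^sup>2) / 2"
    by (simp add: dot_norm J_simps)
  also have "\<dots> = (norm z)\<^sup>2 * (((norm (u + v))\<^sup>2 - (norm u)\<^sup>2 - (norm v)\<^sup>2) / 2)"
    by (simp add: J_norm power_mult_distrib algebra_simps diff_divide_distrib)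
  finally show ?thesis by (simp add: dot_norm[of u v] power2_norm_eq_inner)
qed

text \<open>Here the polarization is in the Clifford argument; it is what evaluates brackets of the
  form \<open>bracket J (J w y) y\<close>.\<close>

lemma J_inner_J': "J z v \<bullet> J w v = (z \<bullet> w) * (v \<bullet> v)"
proof -
  have "J (z + w) v \<bullet> J (z + w) v = ((z + w) \<bullet> (z + w)) * (v \<bullet> v)"
    by (rule J_inner_J)
  then show ?thesis
    using inner_commute[of "J w v" "J z v"] inner_commute[of w z]
    by (simp add: J_simps inner_add J_inner_J algebra_simps)
qed

lemma J_J: "J z (J z v) = - ((z \<bullet> z) *\<^sub>R v)"
  by (simp add: J_clifford power2_norm_eq_inner)

text \<open>\<open>J z\<close> preserves inner products up to the factor
  \<open>z \<bullet> z\<close> and squares to minus that factor, so applying it to both entries of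
  \<open>u \<bullet> J z v\<close> moves it across with a sign. The factor cancels unless
  \<open>z = 0\<close>, where both sides vanish.\<close>

lemma J_skew: "J z u \<bullet> v = - (u \<bullet> J z v)"
proof (cases "z = 0")
  case False
  have "(z \<bullet> z) * (u \<bullet> J z v) = J z u \<bullet> J z (J z v)"
    by (simp only: J_inner_J)
  also have "\<dots> = - (z \<bullet> z) * (J z u \<bullet> v)"
    by (simp add: J_J)
  finally have "(z \<bullet> z) * (J z u \<bullet> v + u \<bullet> J z v) = 0"
    by (simp add: distrib_left)
  then show ?thesis using False by (simp add: eq_neg_iff_add_eq_0)
qed (simp add: J_simps)

lemma bracket_inner': "z \<bullet> bracket J v w = J z v \<bullet> w"
  by (metis bracket_inner inner_commute)

lemma bounded_bilinear_bracket: "bounded_bilinear (bracket J)"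
proof -
  have "bilinear (bracket J)"
    unfolding bilinear_def
    by (intro conjI allI linearI; rule iffD1[OF vector_eq_rdot], intro allI)
      (simp_all add: inner_add_left bracket_inner J_simps inner_add_right)
  then show ?thesis using bilinear_conv_bounded_bilinear by blast
qed

lemmas bracket_simps =
  bounded_bilinear.add_left[OF bounded_bilinear_bracket]
  bounded_bilinear.add_right[OF bounded_bilinear_bracket]
  bounded_bilinear.diff_left[OF bounded_bilinear_bracket]
  bounded_bilinear.diff_right[OF bounded_bilinear_bracket]
  bounded_bilinear.scaleR_left[OF bounded_bilinear_bracket]
  bounded_bilinear.scaleR_right[OF bounded_bilinear_bracket]
  bounded_bilinear.minus_left[OF bounded_bilinear_bracket]
  bounded_bilinear.minus_right[OF bounded_bilinear_bracket]
  bounded_bilinear.zero_left[OF bounded_bilinear_bracket]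
  bounded_bilinear.zero_right[OF bounded_bilinear_bracket]

lemmas bracket_has_derivative [derivative_intros] =
  bounded_bilinear.FDERIV[OF bounded_bilinear_bracket]

lemmas J_has_derivative [derivative_intros] =
  bounded_bilinear.FDERIV[OF bounded_bilinear_J]

lemma bracket_swap: "bracket J v w = - bracket J w v"
proof -
  have "bracket J v w \<bullet> z = - bracket J w v \<bullet> z" for z
    using J_skew[of z v w] by (simp add: bracket_inner inner_commute[of v "J z w"])
  then have "\<forall>z. bracket J v w \<bullet> z = - bracket J w v \<bullet> z" by blast
  then show ?thesis by (simp only: vector_eq_rdot)
qed

section \<open>The inverse metric and gradients\<close>

definition sharp :: "'v \<times> 'z \<times> real \<Rightarrow> 'v \<times> 'z \<times> real \<Rightarrow> 'v \<times> 'z \<times> real" where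
  "sharp = (\<lambda>(v, z, t) (a, b, c).
     (t *\<^sub>R (a + (1/2) *\<^sub>R J b v), t\<^sup>2 *\<^sub>R b - (t/2) *\<^sub>R bracket J (a + (1/2) *\<^sub>R J b v) v, t\<^sup>2 * c))"

text \<open>Thus \<open>sharp\<close> is the musical isomorphism raising indices, with covectors
  represented through the inner product of the ambient product space.\<close>

lemma dr_metric_sharp:
  assumes "p \<in> half_space"
  shows "dr_metric J p (sharp p c) Z = c \<bullet> Z"
proof -
  obtain v z t where p: "p = (v, z, t)" by (cases p)
  obtain a b d where c: "c = (a, b, d)" by (cases c)
  obtain x y s where Z: "Z = (x, y, s)" by (cases Z)
  note eqs = p c Z
  have t: "t > 0" using assms by (simp add: eqs half_space_def)
  show ?thesis
    using t unfolding eqs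
    by (simp add: dr_metric_def sharp_def bracket_simps J_simps inner_add inner_diff bracket_inner'
        J_skew[of _ x v] inner_commute[of x] field_simps power2_eq_square)
qed

text \<open>Nondegeneracy, and hence the uniqueness behind the definite descriptions in
  \<open>riem_gradient\<close> and \<open>christoffel\<close>. The order of the test vectors
  matters: once the shifted central components agree, testing with \<open>(w, 0, 0)\<close> isolates
  the first components.\<close>

lemma dr_metric_eqD:
  assumes p: "p \<in> half_space" and eq: "\<And>Z. dr_metric J p X Z = dr_metric J p Y Z"
  shows "X = Y"
proof -
  obtain v z t where p': "p = (v, z, t)" by (cases p)
  obtain x1 x2 x3 where X: "X = (x1, x2, x3)" by (cases X)
  obtain y1 y2 y3 where Y: "Y = (y1, y2, y3)" by (cases Y)
  note eqs = p' X Y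
  have t: "t > 0" using p by (simp add: eqs half_space_def)
  have 3: "x3 = y3"
    using eq[of "(0, 0, 1)"] t by (simp add: eqs dr_metric_def bracket_simps)
  have "\<forall>w. (x2 + (1/2) *\<^sub>R bracket J x1 v) \<bullet> w = (y2 + (1/2) *\<^sub>R bracket J y1 v) \<bullet> w"
    using eq[of "(0, w, 0)" for w] t by (simp add: eqs dr_metric_def bracket_simps)
  then have 2: "x2 + (1/2) *\<^sub>R bracket J x1 v = y2 + (1/2) *\<^sub>R bracket J y1 v"
    by (simp only: vector_eq_rdot)
  have "\<forall>w. x1 \<bullet> w = y1 \<bullet> w"
    using eq[of "(w, 0, 0)" for w] t by (simp add: eqs dr_metric_def 2)
  then have 1: "x1 = y1"
    by (simp only: vector_eq_rdot)
  show ?thesis using 1 2 3 by (simp add: eqs)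
qed

lemma dr_metric_eq_sharp:
  assumes "p \<in> half_space" "\<And>Z. dr_metric J p X Z = c \<bullet> Z"
  shows "X = sharp p c"
  using assms by (intro dr_metric_eqD[of p]) (simp_all add: dr_metric_sharp)

lemma dr_metric_commute: "dr_metric J p X Y = dr_metric J p Y X"
  by (auto simp: dr_metric_def case_prod_unfold inner_commute mult.commute)

text \<open>Both sides are the metric product of \<open>sharp p c\<close> and
  \<open>sharp p d\<close>.\<close>

lemma sharp_selfadjoint:
  assumes "p \<in> half_space"
  shows "sharp p c \<bullet> d = c \<bullet> sharp p d"
  using dr_metric_sharp[OF assms, of c "sharp p d"] dr_metric_sharp[OF assms, of d "sharp p c"]
    dr_metric_commute[of p "sharp p c"]
  by (simp add: inner_commute)

lemma riem_gradient_eq_sharp: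
  assumes p: "p \<in> half_space" and F: "(F has_derivative (\<lambda>Y. c \<bullet> Y)) (at p)"
  shows "riem_gradient (dr_metric J) F p = sharp p c"
  unfolding riem_gradient_def frechet_derivative_at[OF F, symmetric]
  by (rule the_equality) (auto simp: dr_metric_sharp[OF p] intro: dr_metric_eq_sharp[OF p])

section \<open>Derivative of the metric and the Christoffel map\<close>

definition dr_metric_deriv ::
    "'v \<times> 'z \<times> real \<Rightarrow> 'v \<times> 'z \<times> real \<Rightarrow> 'v \<times> 'z \<times> real \<Rightarrow> 'v \<times> 'z \<times> real \<Rightarrow> real" where
  "dr_metric_deriv = (\<lambda>(v, z, t) (v1, z1, t1) (v2, z2, t2) (v3, z3, t3).
     (1 / (2 * t\<^sup>2)) * (bracket J v1 v3 \<bullet> (z2 + (1/2) *\<^sub>R bracket J v2 v)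
        + (z1 + (1/2) *\<^sub>R bracket J v1 v) \<bullet> bracket J v2 v3)
     - t3 / t\<^sup>2 * (v1 \<bullet> v2)
     - 2 * t3 / t^3 * ((z1 + (1/2) *\<^sub>R bracket J v1 v) \<bullet> (z2 + (1/2) *\<^sub>R bracket J v2 v) + t1 * t2))"

lemma dr_metric_has_derivative:
  assumes "p \<in> half_space"
  shows "((\<lambda>q. dr_metric J q X Z) has_derivative dr_metric_deriv p X Z) (at p)"
proof -
  obtain v z t where p: "p = (v, z, t)" by (cases p)
  obtain x y s where X: "X = (x, y, s)" by (cases X)
  obtain x' y' s' where Z: "Z = (x', y', s')" by (cases Z)
  note eqs = p X Z
  have t: "t > 0" using assms by (simp add: eqs half_space_def)
  \<comment> \<open>In terms of \<open>h\<close>, \<open>h'\<close> and the reciprocal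
    \<open>i\<close> of the last coordinate the metric is a polynomial expression, so the product
    rule suffices.\<close>
  define h where "h = (\<lambda>q :: 'v \<times> 'z \<times> real. y + (1/2) *\<^sub>R bracket J x (fst q))"
  define h' where "h' = (\<lambda>q :: 'v \<times> 'z \<times> real. y' + (1/2) *\<^sub>R bracket J x' (fst q))"
  have dh: "(h has_derivative (\<lambda>Y. (1/2) *\<^sub>R bracket J x (fst Y))) (at p)"
    "(h' has_derivative (\<lambda>Y. (1/2) *\<^sub>R bracket J x' (fst Y))) (at p)"
    unfolding h_def h'_def by (auto intro!: derivative_eq_intros simp: bracket_simps)
  define i where "i = (\<lambda>q :: 'v \<times> 'z \<times> real. inverse (snd (snd q)))"
  have di: "(i has_derivative (\<lambda>Y. - (i p * snd (snd Y) * i p))) (at p)"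
    unfolding i_def
    by (intro Deriv.has_derivative_inverse has_derivative_snd has_derivative_ident) (use t eqs in simp)
  note deriv = has_derivative_add[OF has_derivative_mult_left[OF di, of "x \<bullet> x'"]
      has_derivative_mult[OF has_derivative_mult[OF di di]
        has_derivative_add[OF has_derivative_inner[OF dh] has_derivative_const[of "s * s'"]]]]
  have "((\<lambda>q. i q * (x \<bullet> x') + i q * i q * (h q \<bullet> h' q + s * s')) has_derivative
      dr_metric_deriv p X Z) (at p)"
  proof (rule has_derivative_eq_rhs[OF deriv], rule ext)
    fix Y
    have h: "h p = y + (1/2) *\<^sub>R bracket J x v" "h' p = y' + (1/2) *\<^sub>R bracket J x' v" "i p = inverse t"
      by (simp_all add: h_def h'_def i_def eqs)
    have "dr_metric_deriv p X Z Y
      = (1 / (2 * t\<^sup>2)) * (bracket J x (fst Y) \<bullet> h' p + h p \<bullet> bracket J x' (fst Y))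
        - snd (snd Y) / t\<^sup>2 * (x \<bullet> x') - 2 * snd (snd Y) / t ^ 3 * (h p \<bullet> h' p + s * s')"
      unfolding h by (simp add: dr_metric_deriv_def eqs case_prod_unfold)
    then show "- (i p * snd (snd Y) * i p) * (x \<bullet> x')
      + (i p * i p * (h p \<bullet> (1/2) *\<^sub>R bracket J x' (fst Y) + (1/2) *\<^sub>R bracket J x (fst Y) \<bullet> h' p + 0)
        + (i p * - (i p * snd (snd Y) * i p) + - (i p * snd (snd Y) * i p) * i p)
          * (h p \<bullet> h' p + s * s'))
      = dr_metric_deriv p X Z Y"
      using t unfolding h(3) by (simp add: power2_eq_square power3_eq_cube field_simps)
  qed
  moreover have "dr_metric J q X Z = i q * (x \<bullet> x') + i q * i q * (h q \<bullet> h' q + s * s')" for q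
    by (simp add: dr_metric_def h_def h'_def i_def eqs case_prod_unfold power2_eq_square
        add_divide_distrib distrib_left inverse_eq_divide)
  ultimately show ?thesis by (simp only:)
qed

lemma linear_dr_metric_deriv:
  "linear (\<lambda>X. dr_metric_deriv p X Z Y)" "linear (\<lambda>Z. dr_metric_deriv p X Z Y)"
  "linear (dr_metric_deriv p X Z)"
  by (rule linearI; simp add: dr_metric_deriv_def case_prod_unfold bracket_simps inner_add
      algebra_simps add_divide_distrib)+

text \<open>The Koszul expression is linear in its test vector, hence of the form
  \<open>a \<bullet> Z\<close>, and the Christoffel vector is \<open>sharp p\<close> of half of
  \<open>a\<close>. Self-adjointness moves \<open>sharp p\<close> onto \<open>b\<close>, so no
  explicit Christoffel symbols are needed.\<close>

lemma christoffel_inner: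
  assumes p: "p \<in> half_space"
  shows "christoffel (dr_metric J) p Y X \<bullet> b = (dr_metric_deriv p X (sharp p b) Y
    + dr_metric_deriv p Y (sharp p b) X - dr_metric_deriv p X Y (sharp p b)) / 2"
proof -
  define \<phi> where "\<phi> Z = dr_metric_deriv p X Z Y + dr_metric_deriv p Y Z X
    - dr_metric_deriv p X Y Z" for Z
  have "linear \<phi>"
    unfolding \<phi>_def
    by (intro linear_compose_add linear_compose_sub linear_dr_metric_deriv)
  then obtain a where a: "\<And>Z. \<phi> Z = a \<bullet> Z"
    by (rule linear_eq_inner) blast
  have "christoffel (dr_metric J) p Y X = sharp p ((1/2) *\<^sub>R a)"
    unfolding christoffel_def
      frechet_derivative_at[OF dr_metric_has_derivative[OF p], symmetric] \<phi>_def[symmetric] a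
    by (rule the_equality)
      (auto simp: dr_metric_sharp[OF p] field_simps intro!: dr_metric_eq_sharp[OF p])
  then show ?thesis
    using a[of "sharp p b"] by (simp add: sharp_selfadjoint[OF p] \<phi>_def)
qed

section \<open>The trace of the Christoffel map and the divergence\<close>

lemma sum_bracket_inner_bracket:
  "(\<Sum>e\<in>Basis. bracket J e u \<bullet> bracket J e v) = DIM('z) * (u \<bullet> v)"
proof -
  have J: "bracket J e w \<bullet> f = - (J f w \<bullet> e)" for e f w
    using J_skew[of f e w] by (simp add: bracket_inner inner_commute[of e])
  have "(\<Sum>e\<in>Basis. bracket J e u \<bullet> bracket J e v)
      = (\<Sum>e\<in>Basis. \<Sum>f\<in>Basis. (J f u \<bullet> e) * (J f v \<bullet> e))"
    by (subst euclidean_inner) (simp add: J)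
  also have "\<dots> = (\<Sum>f\<in>Basis. J f u \<bullet> J f v)"
    by (subst sum.swap) (simp flip: euclidean_inner)
  also have "\<dots> = DIM('z) * (u \<bullet> v)"
    by (simp add: J_inner_J)
  finally show ?thesis .
qed

text \<open>In classical notation this is \<open>\<Gamma>\<^sup>i\<^sub>i\<^sub>j X\<^sup>j = X(ln \<surd>det g)\<close>; up to a constant,
  \<open>\<surd>det g\<close> is the power of \<open>t\<close> with exponent \<open>- (n/2 + dim \<zz> + 1)\<close>.\<close>

lemma trace_christoffel:
  assumes "t > 0"
  shows "(\<Sum>b\<in>Basis. christoffel (dr_metric J) (v, z, t) b (x, y, s) \<bullet> b)
    = - ((DIM('v) / 2 + DIM('z) + 1) * s / t)"
proof -
  let ?p = "(v, z, t)" and ?X = "(x, y, s)"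
  let ?D = "dr_metric_deriv ?p"
  have p: "?p \<in> half_space" using assms by (simp add: half_space_def)
  \<comment> \<open>In the trace the first and third Koszul terms cancel by symmetry of the inverse
    metric; only the derivative of the metric in direction \<open>?X\<close> survives.\<close>
  have "bilinear (\<lambda>Y Z. ?D ?X Z Y)"
    using linear_dr_metric_deriv by (simp add: bilinear_def)
  then have "(\<Sum>b\<in>Basis. ?D ?X (sharp ?p b) b) = (\<Sum>b\<in>Basis. ?D ?X b (sharp ?p b))"
    by (rule sum_bilinear_selfadjoint) (rule sharp_selfadjoint[OF p])
  then have "(\<Sum>b\<in>Basis. christoffel (dr_metric J) ?p b ?X \<bullet> b)
    = (\<Sum>b\<in>Basis. ?D b (sharp ?p b) ?X) / 2"
    by (simp add: christoffel_inner[OF p] sum.distrib sum_subtractf flip: sum_divide_distrib)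
  \<comment> \<open>The three blocks of the basis are evaluated separately. After summation the
    terms with \<open>v \<bullet> x\<close> from the first two blocks cancel, by
    \<open>sum_bracket_inner_bracket\<close>.\<close>
  moreover have "?D (e, 0, 0) (sharp ?p (e, 0, 0)) ?X
      = (bracket J e v \<bullet> bracket J e x) / (4 * t) - s / t" if "e \<in> Basis" for e
    using assms that
    by (simp add: dr_metric_deriv_def sharp_def bracket_simps J_simps inner_commute
        field_simps power2_eq_square power3_eq_cube)
  moreover have "?D (0, f, 0) (sharp ?p (0, f, 0)) ?X = - (v \<bullet> x) / (4 * t) - 2 * s / t"
    if "f \<in> Basis" for f
    using assms that
    by (simp add: dr_metric_deriv_def sharp_def bracket_simps J_simps bracket_inner' J_J
        field_simps power2_eq_square power3_eq_cube)
  moreover have "?D (0, 0, 1) (sharp ?p (0, 0, 1)) ?X = - 2 * s / t"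
    using assms
    by (simp add: dr_metric_deriv_def sharp_def bracket_simps J_simps
        field_simps power2_eq_square power3_eq_cube)
  ultimately have "(\<Sum>b\<in>Basis. christoffel (dr_metric J) ?p b ?X \<bullet> b)
    = ((DIM('z) * (v \<bullet> x) / (4 * t) - DIM('v) * (s / t))
      + (DIM('z) * (- (v \<bullet> x) / (4 * t) - 2 * s / t) - 2 * s / t)) / 2"
    by (simp add: sum_Basis_prod[of "\<lambda>b. ?D b (sharp ?p b) ?X"] sum_Basis_prod[of "\<lambda>b. ?D (0, b) (sharp ?p (0, b)) ?X"]
         zero_prod_def sum_subtractf sum_bracket_inner_bracket flip: sum_divide_distrib)
  also have "\<dots> = - ((DIM('v) / 2 + DIM('z) + 1) * s / t)"
    using assms by (simp add: field_simps)
  finally show ?thesis .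
qed

lemma riem_divergence_dr_metric:
  assumes p: "(v, z, t) \<in> half_space" and V: "(V has_derivative V') (at (v, z, t))"
  shows "riem_divergence (dr_metric J) V (v, z, t) = (\<Sum>b\<in>Basis. V' b \<bullet> b)
    - (DIM('v) / 2 + DIM('z) + 1) * snd (snd (V (v, z, t))) / t"
proof -
  have t: "t > 0" using p by (simp add: half_space_def)
  obtain x y s where X: "V (v, z, t) = (x, y, s)"
    by (metis prod.exhaust)
  show ?thesis
    unfolding riem_divergence_def levi_civita_def frechet_derivative_at[OF V, symmetric] X
      inner_add_left sum.distrib trace_christoffel[OF t]
    by simp
qed

end

section \<open>Orthogonal decompositions\<close>

text \<open>Openness allows the gradient field to be replaced by a closed form before it is
  differentiated.\<close>

lemma open_half_space: "open (half_space :: ('v::euclidean_space \<times> 'z::euclidean_space \<times> real) set)"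
proof -
  have "half_space = (\<lambda>q :: 'v \<times> 'z \<times> real. snd (snd q)) -` {0<..}"
    by (auto simp: half_space_def)
  moreover have "open ((\<lambda>q :: 'v \<times> 'z \<times> real. snd (snd q)) -` {0<..})"
    by (intro open_vimage open_greaterThan continuous_intros)
  ultimately show ?thesis by metis
qed

text \<open>The difference of the two candidates lies in \<open>V\<close> and is orthogonal to
  \<open>V\<close>, hence to itself.\<close>

lemma orth_proj_eqI:
  assumes "subspace V" "x \<in> V" "\<And>y. y \<in> V \<Longrightarrow> (v - x) \<bullet> y = 0"
  shows "orth_proj V v = x"
proof -
  let ?d = "orth_proj V v - x"
  have "?d \<in> V"
    by (intro subspace_diff orth_proj(1) assms)
  then have "(v - x) \<bullet> ?d = 0" "(v - orth_proj V v) \<bullet> ?d = 0"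
    using assms orth_proj(2)[OF assms(1)] by (auto simp: orthogonal_def)
  then have "?d \<bullet> ?d = 0"
    by (simp add: inner_diff_left)
  then show ?thesis by simp
qed

lemma orth_proj_inner_left: "subspace V \<Longrightarrow> y \<in> V \<Longrightarrow> orth_proj V v \<bullet> y = v \<bullet> y"
  using orth_proj(2)[of V y v] by (simp add: orthogonal_def inner_diff_left)

lemma linear_orth_proj:
  assumes "subspace V"
  shows "linear (orth_proj V)"
  by (rule linearI; rule orth_proj_eqI)
    (simp_all add: assms orth_proj(1) subspace_add subspace_scale orth_proj_inner_left
      inner_diff_left inner_add_left)

lemma orth_proj_selfadjoint:
  assumes "subspace V"
  shows "orth_proj V u \<bullet> v = u \<bullet> orth_proj V v"
  using orth_proj_inner_left[OF assms orth_proj(1)[OF assms], of u v]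
    orth_proj_inner_left[OF assms orth_proj(1)[OF assms], of v u]
  by (simp add: inner_commute)

locale damek_ricci_decomposition = damek_ricci J
  for J :: "'z::euclidean_space \<Rightarrow> 'v::euclidean_space \<Rightarrow> 'v" +
  fixes V1 V2 :: "'v set"
  assumes subspace_V1: "subspace V1" and subspace_V2: "subspace V2"
    and V1_V2_orthogonal: "x \<in> V1 \<Longrightarrow> y \<in> V2 \<Longrightarrow> x \<bullet> y = 0"
    and V1_V2_sum: "\<exists>x\<in>V1. \<exists>y\<in>V2. v = x + y"
begin

abbreviation P1 :: "'v \<Rightarrow> 'v" where "P1 \<equiv> orth_proj V1"
abbreviation P2 :: "'v \<Rightarrow> 'v" where "P2 \<equiv> orth_proj V2"

lemma P_in [simp]: "P1 v \<in> V1" "P2 v \<in> V2"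
  using orth_proj(1) subspace_V1 subspace_V2 by auto

lemma P_id [simp]: "x \<in> V1 \<Longrightarrow> P1 x = x" "y \<in> V2 \<Longrightarrow> P2 y = y"
  by (auto intro!: orth_proj_eqI subspace_V1 subspace_V2)

lemma V_inner_zero [simp]:
  "x \<in> V1 \<Longrightarrow> y \<in> V2 \<Longrightarrow> x \<bullet> y = 0" "x \<in> V1 \<Longrightarrow> y \<in> V2 \<Longrightarrow> y \<bullet> x = 0"
  using V1_V2_orthogonal by (auto simp: inner_commute)

lemma P_zero [simp]: "x \<in> V1 \<Longrightarrow> P2 x = 0" "y \<in> V2 \<Longrightarrow> P1 y = 0"
  by (auto intro!: orth_proj_eqI subspace_V1 subspace_V2 subspace_0)

lemmas linear_P = linear_orth_proj[OF subspace_V1] linear_orth_proj[OF subspace_V2]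

lemmas P_simps =
  linear_add[OF linear_P(1)] linear_add[OF linear_P(2)]
  linear_cmul[OF linear_P(1)] linear_cmul[OF linear_P(2)]
  linear_0[OF linear_P(1)] linear_0[OF linear_P(2)]

lemmas P_has_derivative [derivative_intros] =
  bounded_linear.has_derivative[OF linear_P(1)[unfolded linear_conv_bounded_linear]]
  bounded_linear.has_derivative[OF linear_P(2)[unfolded linear_conv_bounded_linear]]

lemmas P_selfadjoint = orth_proj_selfadjoint[OF subspace_V1] orth_proj_selfadjoint[OF subspace_V2]

lemma P_add: "P1 v + P2 v = v"
  using V1_V2_sum[of v] by (auto simp: P_simps)

lemma inner_P_P: "P1 u \<bullet> P1 u + P2 u \<bullet> P2 u = u \<bullet> u"
proof -
  have "u \<bullet> u = (P1 u + P2 u) \<bullet> (P1 u + P2 u)" by (simp only: P_add)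
  then show ?thesis by (simp add: inner_add)
qed

section \<open>The function \<open>F\<close>, its differential and the norm of its gradient\<close>

definition height :: "'v \<times> 'z \<times> real \<Rightarrow> real" where
  "height q = snd (snd q) + (1/2) * (P2 (fst q) \<bullet> P2 (fst q))"

definition center :: "'v \<times> 'z \<times> real \<Rightarrow> 'z" where
  "center q = fst (snd q) - (1/2) *\<^sub>R bracket J (P1 (fst q)) (P2 (fst q))"

abbreviation F :: "'v \<times> 'z \<times> real \<Rightarrow> real" where "F \<equiv> dr_function J V1 V2"

lemma F_eq: "F q = ((height q)\<^sup>2 + center q \<bullet> center q) / (snd (snd q))\<^sup>2"
  by (simp add: dr_function_def height_def center_def case_prod_unfold power2_norm_eq_inner)

lemma height_has_derivative [derivative_intros]:
  "(height has_derivative (\<lambda>Y. snd (snd Y) + P2 (fst p) \<bullet> P2 (fst Y))) (at p)"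
  unfolding height_def
  by (auto intro!: derivative_eq_intros simp: inner_commute)

lemma center_has_derivative [derivative_intros]:
  "(center has_derivative (\<lambda>Y. fst (snd Y) - (1/2) *\<^sub>R
      (bracket J (P1 (fst p)) (P2 (fst Y)) + bracket J (P1 (fst Y)) (P2 (fst p))))) (at p)"
  unfolding center_def
  by (auto intro!: derivative_eq_intros)

lemma smooth_on_F: "smooth_on half_space F"
proof -
  have P1: "Ck_on k half_space (\<lambda>q. J c (P1 (fst q)) \<bullet> b)"
    and P2: "Ck_on k half_space (\<lambda>q. P2 (fst q) \<bullet> b)"
    and fst_snd: "Ck_on k half_space (\<lambda>q. fst (snd q) \<bullet> c)"
    and snd_snd: "Ck_on k half_space (\<lambda>q. snd (snd q))"
    for k b c
    by (rule Ck_on_linear, rule linearI; simp add: P_simps J_simps inner_add_left)+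
  have height: "Ck_on k half_space height" for k
    unfolding height_def by (intro Ck_on_add Ck_on_mult Ck_on_const Ck_on_inner[OF P2 P2] snd_snd)
  have center: "Ck_on k half_space (\<lambda>q. center q \<bullet> c)" for k c
    unfolding center_def inner_diff_left inner_scaleR_left bracket_inner
    by (intro Ck_on_diff Ck_on_mult Ck_on_const Ck_on_inner[OF P1 P2] fst_snd)
  have "Ck_on k half_space
      (\<lambda>q. ((height q)\<^sup>2 + center q \<bullet> center q) * (inverse (snd (snd q)))\<^sup>2)" for k
    by (intro Ck_on_mult Ck_on_add Ck_on_power height Ck_on_inner[OF center center] Ck_on_inverse snd_snd)
      (auto simp: half_space_def)
  then show ?thesis
    unfolding smooth_on_def F_eq[abs_def] divide_inverse power_inverse[symmetric] by blast
qed

text \<open>The gradient of \<open>F\<close> with respect to the inner product of the ambient space;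
  \<open>sharp\<close> turns it into the Riemannian gradient.\<close>

definition F_deriv :: "'v \<times> 'z \<times> real \<Rightarrow> 'v \<times> 'z \<times> real" where
  "F_deriv = (\<lambda>(v, z, t). let x = P1 v; y = P2 v; A = height (v, z, t); w = center (v, z, t) in
     ((1 / t\<^sup>2) *\<^sub>R ((2 * A) *\<^sub>R y + P1 (J w y) - P2 (J w x)), (2 / t\<^sup>2) *\<^sub>R w,
      2 * A / t\<^sup>2 - 2 * (A\<^sup>2 + w \<bullet> w) / t ^ 3))"

lemma F_has_derivative:
  assumes "p \<in> half_space"
  shows "(F has_derivative (\<lambda>Y. F_deriv p \<bullet> Y)) (at p)"
proof -
  obtain v z t where p: "p = (v, z, t)" by (cases p)
  have t: "t > 0" using assms by (simp add: p half_space_def)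
  define w where "w = center p"
  define A where "A = height p"
  let ?dA = "\<lambda>Y :: 'v \<times> 'z \<times> real. snd (snd Y) + P2 v \<bullet> P2 (fst Y)"
  let ?dw = "\<lambda>Y :: 'v \<times> 'z \<times> real. fst (snd Y) - (1/2) *\<^sub>R
      (bracket J (P1 v) (P2 (fst Y)) + bracket J (P1 (fst Y)) (P2 v))"
  have "(F has_derivative (\<lambda>Y. (2 * A * ?dA Y + 2 * (w \<bullet> ?dw Y)) / t\<^sup>2
      - 2 * (A\<^sup>2 + w \<bullet> w) * snd (snd Y) / t ^ 3)) (at p)"
  proof -
    have "height p = A" "center p = w" "snd (snd p) = t" "fst p = v"
      by (simp_all add: A_def w_def p)
    note eqs = this
    show ?thesis
      unfolding F_eq[abs_def]
      by (rule derivative_eq_intros refl | (simp add: eqs t less_imp_neq[symmetric]; fail))+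
        (use t in \<open>simp add: eqs inner_commute fun_eq_iff; simp add: field_simps power2_eq_square power3_eq_cube\<close>)
  qed
  moreover have "(2 * A * ?dA Y + 2 * (w \<bullet> ?dw Y)) / t\<^sup>2
      - 2 * (A\<^sup>2 + w \<bullet> w) * snd (snd Y) / t ^ 3 = F_deriv p \<bullet> Y" for Y
  proof -
    obtain a b c where Y: "Y = (a, b, c)" by (cases Y)
    \<comment> \<open>These three identities move every projection off the direction
      \<open>a\<close>, so that the differential becomes an inner product with \<open>Y\<close>; the
      sign in the second comes from skewness of \<open>J w\<close>.\<close>
    have 1: "w \<bullet> bracket J (P1 v) (P2 a) = P2 (J w (P1 v)) \<bullet> a"
      by (simp add: bracket_inner' P_selfadjoint)
    have 2: "w \<bullet> bracket J (P1 a) (P2 v) = - (P1 (J w (P2 v)) \<bullet> a)"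
      unfolding bracket_inner' J_skew[of w "P1 a"] P_selfadjoint(1)[of a] by (simp add: inner_commute)
    have 3: "P2 v \<bullet> P2 a = P2 v \<bullet> a"
      by (simp flip: P_selfadjoint)
    show ?thesis
      unfolding F_deriv_def p prod.case Let_def Y fst_conv snd_conv
        w_def[unfolded p, symmetric] A_def[unfolded p, symmetric]
      using t
      by (simp add: inner_add_left inner_diff inner_add_right 1 2 3)
        (simp add: field_simps power2_eq_square power3_eq_cube)
  qed
  ultimately show ?thesis by simp
qed

text \<open>If \<open>J\<close> interchanges \<open>V1\<close> and \<open>V2\<close>, then
  \<open>c\<close> and \<open>d\<close> vanish. If \<open>v\<close> lies in one summand, only a
  single square survives: \<open>d \<bullet> d\<close> on \<open>V1\<close> and
  \<open>- 3 * (c \<bullet> c)\<close> on \<open>V2\<close>.\<close>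

definition defect :: "'v \<times> 'z \<times> real \<Rightarrow> real" where
  "defect = (\<lambda>(v, z, t). let a = P1 (J (center (v, z, t)) (P2 v)); c = P2 (J (center (v, z, t)) (P2 v));
       d = P1 (J (center (v, z, t)) (P1 v))
     in (4 * (a \<bullet> d) + d \<bullet> d - 3 * (c \<bullet> c)) / t ^ 3)"

lemma norm_gradient:
  assumes p: "p \<in> half_space"
  shows "dr_metric J p (riem_gradient (dr_metric J) F p) (riem_gradient (dr_metric J) F p)
    = 4 * F p * (F p - 1) + defect p"
proof -
  obtain v z t where peq: "p = (v, z, t)" by (cases p)
  have t: "t > 0" using p by (simp add: peq half_space_def)
  define w where "w = center p"
  define A where "A = height p"
  define x where "x = P1 v"
  define y where "y = P2 v"
  define a where "a = P1 (J w y)"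
  define c where "c = P2 (J w y)"
  define d where "d = P1 (J w x)"
  have mem: "a \<in> V1" "d \<in> V1" "c \<in> V2" "y \<in> V2"
    by (simp_all add: a_def c_def d_def y_def)
  have ac: "J w y = a + c" and xd: "J w x = d + P2 (J w x)" and v: "v = x + y"
    by (simp_all add: a_def c_def d_def x_def y_def P_add)
  have yc: "y \<bullet> c = 0" "c \<bullet> y = 0"
    using J_skew[of w y y] ac mem by (auto simp: inner_add inner_commute)
  have aacc: "a \<bullet> a + c \<bullet> c = (w \<bullet> w) * (y \<bullet> y)"
    using J_inner_J[of w y y] inner_P_P[of "J w y"] by (simp add: a_def c_def)
  have yy: "y \<bullet> y = 2 * (A - t)"
    by (simp add: A_def height_def peq y_def)
  \<comment> \<open>\<open>h\<close> is the first component of the differential plus half of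
    \<open>J \<beta> v\<close>, where \<open>\<beta>\<close> is the central component. It is the
    combination occurring in \<open>sharp\<close>, and it makes the squared norm a sum of three
    squares.\<close>
  define h where "h = (1 / t\<^sup>2) *\<^sub>R ((2 * A) *\<^sub>R y + 2 *\<^sub>R a + c + d)"
  define \<tau> where "\<tau> = 2 * A / t\<^sup>2 - 2 * (A\<^sup>2 + w \<bullet> w) / t ^ 3"
  have c: "F_deriv p = (h - (1/2) *\<^sub>R J ((2 / t\<^sup>2) *\<^sub>R w) v, (2 / t\<^sup>2) *\<^sub>R w, \<tau>)"
  proof -
    have 1: "(2 * A) *\<^sub>R y + a - P2 (J w x) = ((2 * A) *\<^sub>R y + 2 *\<^sub>R a + c + d) - J w v"
      unfolding v J_simps ac by (subst (2) xd) (simp add: scaleR_2)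
    have 2: "F_deriv p = ((1 / t\<^sup>2) *\<^sub>R ((2 * A) *\<^sub>R y + a - P2 (J w x)), (2 / t\<^sup>2) *\<^sub>R w, \<tau>)"
      by (simp add: F_deriv_def peq Let_def w_def A_def x_def y_def \<tau>_def a_def)
    show ?thesis
      unfolding 2 1 h_def by (simp add: J_simps scaleR_diff_right)
  qed
  have "dr_metric J p (riem_gradient (dr_metric J) F p) (riem_gradient (dr_metric J) F p)
      = F_deriv p \<bullet> sharp p (F_deriv p)"
    by (simp add: riem_gradient_eq_sharp[OF p F_has_derivative[OF p]] dr_metric_sharp[OF p])
  also have "\<dots> = t * (h \<bullet> h) + t\<^sup>2 * ((2 / t\<^sup>2) *\<^sub>R w \<bullet> (2 / t\<^sup>2) *\<^sub>R w) + t\<^sup>2 * \<tau>\<^sup>2"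
  proof -
    define \<beta> where "\<beta> = (2 / t\<^sup>2) *\<^sub>R w"
    have \<beta>: "\<beta> \<bullet> bracket J h v = - (J \<beta> v \<bullet> h)"
      by (simp add: bracket_inner' J_skew[of _ h] inner_commute[of h])
    have "F_deriv p \<bullet> sharp p (F_deriv p)
      = (h - (1/2) *\<^sub>R J \<beta> v) \<bullet> t *\<^sub>R h + (\<beta> \<bullet> (t\<^sup>2 *\<^sub>R \<beta> - (t/2) *\<^sub>R bracket J h v) + \<tau> * (t\<^sup>2 * \<tau>))"
      unfolding c by (simp add: sharp_def peq \<beta>_def)
    then show ?thesis
      unfolding \<beta>_def[symmetric]
      by (simp add: inner_diff_left inner_diff_right \<beta> power2_eq_square right_diff_distrib)
  qed
  also have "h \<bullet> h = (4 * A\<^sup>2 * (y \<bullet> y) + 4 * (a \<bullet> a) + 4 * (a \<bullet> d) + d \<bullet> d + c \<bullet> c) / t ^ 4"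
    using mem yc by (simp add: h_def inner_add inner_commute[of d a] power2_eq_square)
      (use t in \<open>simp add: eval_nat_numeral field_simps\<close>)
  \<comment> \<open>The coefficient 3 arises from replacing \<open>a \<bullet> a\<close> by
    \<open>(w \<bullet> w) * (y \<bullet> y) - c \<bullet> c\<close>.\<close>
  also have "4 * A\<^sup>2 * (y \<bullet> y) + 4 * (a \<bullet> a) + 4 * (a \<bullet> d) + d \<bullet> d + c \<bullet> c
      = 8 * (A\<^sup>2 + w \<bullet> w) * (A - t) + (4 * (a \<bullet> d) + d \<bullet> d - 3 * (c \<bullet> c))"
    using aacc unfolding yy by (simp add: algebra_simps)
  also have "t * ((8 * (A\<^sup>2 + w \<bullet> w) * (A - t) + (4 * (a \<bullet> d) + d \<bullet> d - 3 * (c \<bullet> c))) / t ^ 4)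
      + t\<^sup>2 * ((2 / t\<^sup>2) *\<^sub>R w \<bullet> (2 / t\<^sup>2) *\<^sub>R w) + t\<^sup>2 * \<tau>\<^sup>2
    = 4 * ((A\<^sup>2 + w \<bullet> w) / t\<^sup>2) * ((A\<^sup>2 + w \<bullet> w) / t\<^sup>2 - 1)
      + (4 * (a \<bullet> d) + d \<bullet> d - 3 * (c \<bullet> c)) / t ^ 3"
    using t unfolding \<tau>_def inner_scaleR_left inner_scaleR_right
    by (simp add: divide_simps) (simp add: eval_nat_numeral algebra_simps)
  also have "\<dots> = 4 * F p * (F p - 1) + defect p"
    by (simp add: F_eq defect_def Let_def a_def c_def d_def x_def y_def w_def A_def peq)
  finally show ?thesis .
qed

section \<open>The criterion for transnormality\<close>

definition totally_real :: bool where
  "totally_real \<longleftrightarrow> (\<forall>z. \<forall>x\<in>V1. J z x \<in> V2) \<and> (\<forall>z. \<forall>y\<in>V2. J z y \<in> V1)"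

lemma F_ge_1:
  assumes "p \<in> half_space"
  shows "F p \<ge> 1"
proof -
  obtain v z t where p: "p = (v, z, t)" by (cases p)
  have t: "t > 0" using assms by (simp add: p half_space_def)
  have "t\<^sup>2 \<le> (height p)\<^sup>2"
    using t by (intro power_mono) (auto simp: height_def p)
  then have "t\<^sup>2 \<le> (height p)\<^sup>2 + center p \<bullet> center p"
    by (simp add: add_increasing2)
  then show ?thesis
    using t by (simp add: F_eq p)
qed

text \<open>Since \<open>F (0, z, 1)\<close> is 1 plus the squared norm of \<open>z\<close>, every
  value from 1 on is attained there. These points are the reference on each level set: the defect is
  0 and the ratio of height to \<open>t\<close> is 1.\<close>

lemma vertical_point:
  assumes "p \<in> half_space"
  obtains z where "F (0, z, 1) = F p"
proof
  show "F (0, sqrt (F p - 1) *\<^sub>R (SOME b. b \<in> Basis), 1) = F p"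
    using F_ge_1[OF assms]
    by (simp add: F_eq height_def center_def P_simps bracket_simps some_in_eq)
qed

text \<open>The level set of \<open>p\<close> contains a vertical point, and the value of
  \<open>b\<close> read off there leaves no room for a defect at \<open>p\<close>.\<close>

lemma transnormal_imp_defect:
  assumes "transnormal half_space (dr_metric J) F" and p: "p \<in> half_space"
  shows "defect p = 0"
proof -
  obtain b where b: "\<And>p. p \<in> half_space \<Longrightarrow> 4 * F p * (F p - 1) + defect p = b (F p)"
    using assms(1) unfolding transnormal_def by (auto simp: norm_gradient)
  obtain z where z: "F (0, z, 1) = F p"
    using vertical_point[OF p] .
  have "defect (0, z, 1) = 0"
    by (simp add: defect_def P_simps J_simps)
  then have "b (F p) = 4 * F p * (F p - 1)"
    using b[of "(0, z, 1)"] by (simp add: z half_space_def)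
  then show ?thesis
    using b[OF p] by simp
qed

lemma totally_real_imp_defect:
  assumes "totally_real"
  shows "defect p = 0"
proof -
  have "P1 (J w (P1 v)) = 0" "P2 (J w (P2 v)) = 0" for w v
    using assms by (simp_all add: totally_real_def)
  then show ?thesis by (simp add: defect_def case_prod_unfold)
qed

lemma transnormal_iff: "transnormal half_space (dr_metric J) F \<longleftrightarrow> totally_real"
proof
  assume t: "transnormal half_space (dr_metric J) F"
  show totally_real
    unfolding totally_real_def
  proof (intro conjI allI ballI)
    fix z x assume "x \<in> V1"
    \<comment> \<open>At \<open>(x, z, 1)\<close> the center is \<open>z\<close> and
      \<open>P2 x = 0\<close>, so the defect is the squared norm of
      \<open>P1 (J z x)\<close>.\<close>
    then have "P1 (J z x) = 0"
      using transnormal_imp_defect[OF t, of "(x, z, 1)"]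
      by (simp add: defect_def center_def half_space_def Let_def J_simps P_simps bracket_simps)
    then show "J z x \<in> V2" using P_add[of "J z x"] P_in(2)[of "J z x"] by simp
  next
    fix z y assume "y \<in> V2"
    \<comment> \<open>Likewise the defect at \<open>(y, z, 1)\<close> is \<open>- 3\<close> times
      the squared norm of \<open>P2 (J z y)\<close>.\<close>
    then have "P2 (J z y) = 0"
      using transnormal_imp_defect[OF t, of "(y, z, 1)"]
      by (simp add: defect_def center_def half_space_def Let_def J_simps P_simps bracket_simps)
    then show "J z y \<in> V1" using P_add[of "J z y"] P_in(1)[of "J z y"] by simp
  qed
next
  assume totally_real
  then have "dr_metric J p (riem_gradient (dr_metric J) F p) (riem_gradient (dr_metric J) F p)
      = 4 * F p * (F p - 1)" if "p \<in> half_space" for p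
    using norm_gradient[OF that] totally_real_imp_defect by simp
  moreover have "Ck_on 2 (F ` half_space) (\<lambda>s. 4 * s * (s - 1))"
    by (intro Ck_on_mult Ck_on_diff Ck_on_const Ck_on_linear[OF linear_id, unfolded id_def])
  ultimately show "transnormal half_space (dr_metric J) F"
    unfolding transnormal_def using smooth_on_F by blast
qed


section \<open>The gradient of \<open>F\<close> in the totally real case\<close>

lemma bracket_V1_P2: "totally_real \<Longrightarrow> x \<in> V1 \<Longrightarrow> bracket J x (P2 u) = bracket J x u"
  and bracket_P1_V2: "totally_real \<Longrightarrow> y \<in> V2 \<Longrightarrow> bracket J (P1 u) y = bracket J u y"
proof -
  assume tr: totally_real
  \<comment> \<open>\<open>J z x\<close> lies in the summand orthogonal to the one containing
    \<open>x'\<close>, so brackets within one summand vanish.\<close>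
  have *: "bracket J x x' = 0" if "x \<in> V1 \<and> x' \<in> V1 \<or> x \<in> V2 \<and> x' \<in> V2" for x x'
  proof -
    have "bracket J x x' \<bullet> z = 0 \<bullet> z" for z
      using tr that by (auto simp: bracket_inner totally_real_def)
    then show ?thesis by (rule iffD1[OF vector_eq_rdot, OF allI])
  qed
  show "bracket J x (P2 u) = bracket J x u" if "x \<in> V1"
    using *[of x "P1 u"] that bracket_simps(2)[of x "P1 u" "P2 u"] by (simp add: P_add)
  show "bracket J (P1 u) y = bracket J u y" if "y \<in> V2"
    using *[of "P2 u" y] that bracket_simps(1)[of "P1 u" "P2 u" y] by (simp add: P_add)
qed

definition F_gradient :: "'v \<times> 'z \<times> real \<Rightarrow> 'v \<times> 'z \<times> real" where
  "F_gradient p =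
     ((2 / snd (snd p)) *\<^sub>R (height p *\<^sub>R P2 (fst p) + J (center p) (P2 (fst p))),
      (2 * height p / snd (snd p)) *\<^sub>R fst (snd p),
      2 * height p - 2 * ((height p)\<^sup>2 + center p \<bullet> center p) / snd (snd p))"

lemma riem_gradient_F:
  assumes tr: totally_real and p: "p \<in> half_space"
  shows "riem_gradient (dr_metric J) F p = F_gradient p"
proof -
  obtain v z t where peq: "p = (v, z, t)" by (cases p)
  have t: "t > 0" using p by (simp add: peq half_space_def)
  define w where "w = center p"
  define A where "A = height p"
  define x where "x = P1 v"
  define y where "y = P2 v"
  have mem: "x \<in> V1" "y \<in> V2" "J w x \<in> V2" "J w y \<in> V1"
    using tr by (auto simp: x_def y_def totally_real_def)
  have v: "v = x + y" by (simp add: x_def y_def P_add)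
  have yy: "y \<bullet> y = 2 * (A - t)"
    by (simp add: A_def height_def peq y_def)
  have z: "z = w + (1/2) *\<^sub>R bracket J x y"
    by (simp add: w_def center_def peq x_def y_def)
  have "bracket J y v = - bracket J x y"
    using bracket_swap[of y v] bracket_P1_V2[OF tr mem(2), of v, folded x_def] by simp
  moreover have "bracket J (J w y) v = - (y \<bullet> y) *\<^sub>R w"
  proof -
    have "bracket J (J w y) v = bracket J (J w y) y"
      using bracket_V1_P2[OF tr mem(4), of v] by (simp add: y_def)
    moreover have "bracket J (J w y) y \<bullet> \<zeta> = (- (y \<bullet> y) *\<^sub>R w) \<bullet> \<zeta>" for \<zeta>
      by (simp add: bracket_inner J_skew[of \<zeta>] J_inner_J')
    then have "bracket J (J w y) y = - (y \<bullet> y) *\<^sub>R w"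
      by (rule iffD1[OF vector_eq_rdot, OF allI])
    ultimately show ?thesis by simp
  qed
  \<comment> \<open>By the definition of the height the coefficient of \<open>w\<close> is
    \<open>2 * A / t\<close>, so \<open>w\<close> and the remaining bracket recombine to a multiple
    of \<open>z\<close>.\<close>
  ultimately have "2 *\<^sub>R w - (1 / t) *\<^sub>R bracket J (A *\<^sub>R y + J w y) v
      = (2 + (y \<bullet> y) / t) *\<^sub>R w + (A / t) *\<^sub>R bracket J x y"
    by (simp add: bracket_simps scaleR_add_left scaleR_diff_right)
  also have "2 + (y \<bullet> y) / t = 2 * A / t"
    unfolding yy using t by (simp add: field_simps)
  also have "(2 * A / t) *\<^sub>R w + (A / t) *\<^sub>R bracket J x y = (2 * A / t) *\<^sub>R z"
    by (simp add: z scaleR_add_right)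
  finally have br: "2 *\<^sub>R w - (1 / t) *\<^sub>R bracket J (A *\<^sub>R y + J w y) v = (2 * A / t) *\<^sub>R z" .
  have c: "F_deriv p = ((1 / t\<^sup>2) *\<^sub>R ((2 * A) *\<^sub>R y + J w y - J w x), (2 / t\<^sup>2) *\<^sub>R w,
      2 * A / t\<^sup>2 - 2 * (A\<^sup>2 + w \<bullet> w) / t ^ 3)"
    using mem by (simp add: F_deriv_def peq Let_def w_def[unfolded peq] A_def x_def y_def)
  have h: "(1 / t\<^sup>2) *\<^sub>R ((2 * A) *\<^sub>R y + J w y - J w x) + (1/2) *\<^sub>R J ((2 / t\<^sup>2) *\<^sub>R w) v
      = (2 / t\<^sup>2) *\<^sub>R (A *\<^sub>R y + J w y)"
  proof -
    have "(2 * A) *\<^sub>R y + J w y - J w x + J w v = 2 *\<^sub>R (A *\<^sub>R y + J w y)"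
      unfolding v by (simp add: J_simps scaleR_add_right scaleR_2)
    note 1 = this
    have 2: "(1 / t\<^sup>2) *\<^sub>R a + (1/2) *\<^sub>R J ((2 / t\<^sup>2) *\<^sub>R w) v = (1 / t\<^sup>2) *\<^sub>R (a + J w v)" for a
      by (simp add: J_simps scaleR_add_right)
    show ?thesis unfolding 2 1 by simp
  qed
  have "sharp p (F_deriv p) = ((2 / t) *\<^sub>R (A *\<^sub>R y + J w y),
     2 *\<^sub>R w - (1 / t) *\<^sub>R bracket J (A *\<^sub>R y + J w y) v, 2 * A - 2 * (A\<^sup>2 + w \<bullet> w) / t)"
  proof -
    define X where "X = A *\<^sub>R y + J w y"
    have "sharp p (F_deriv p) = (t *\<^sub>R ((2 / t\<^sup>2) *\<^sub>R X),
       t\<^sup>2 *\<^sub>R ((2 / t\<^sup>2) *\<^sub>R w) - (t / 2) *\<^sub>R bracket J ((2 / t\<^sup>2) *\<^sub>R X) v,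
       t\<^sup>2 * (2 * A / t\<^sup>2 - 2 * (A\<^sup>2 + w \<bullet> w) / t ^ 3))"
      unfolding c by (simp only: peq sharp_def prod.case h X_def)
    moreover have "t\<^sup>2 * (2 * A / t\<^sup>2 - 2 * (A\<^sup>2 + w \<bullet> w) / t ^ 3) = 2 * A - 2 * (A\<^sup>2 + w \<bullet> w) / t"
      using t by (simp add: field_simps power2_eq_square power3_eq_cube)
    moreover have "t\<^sup>2 *\<^sub>R ((2 / t\<^sup>2) *\<^sub>R w) - (t / 2) *\<^sub>R bracket J ((2 / t\<^sup>2) *\<^sub>R X) v
        = 2 *\<^sub>R w - (1 / t) *\<^sub>R bracket J X v"
      and "t *\<^sub>R ((2 / t\<^sup>2) *\<^sub>R X) = (2 / t) *\<^sub>R X"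
      using t by (simp_all add: bracket_simps power2_eq_square)
    ultimately show ?thesis by (simp only: X_def)
  qed
  then show ?thesis
    unfolding riem_gradient_eq_sharp[OF p F_has_derivative[OF p]] br
    by (simp add: F_gradient_def w_def A_def y_def peq)
qed

section \<open>The Laplacian of \<open>F\<close> in the totally real case\<close>

lemma F_gradient_has_derivative:
  fixes v :: 'v and z :: 'z and t :: real
  assumes "t > 0"
  defines "A \<equiv> height (v, z, t)" and "w \<equiv> center (v, z, t)"
    and "dA \<equiv> \<lambda>Y. snd (snd Y) + P2 v \<bullet> P2 (fst Y)"
    and "dw \<equiv> \<lambda>Y. fst (snd Y)
      - (1/2) *\<^sub>R (bracket J (P1 v) (P2 (fst Y)) + bracket J (P1 (fst Y)) (P2 v))"
  shows "(F_gradient has_derivative (\<lambda>Y.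
     ((2 / t) *\<^sub>R (dA Y *\<^sub>R P2 v + A *\<^sub>R P2 (fst Y) + J (dw Y) (P2 v) + J w (P2 (fst Y)))
        - (2 * snd (snd Y) / t\<^sup>2) *\<^sub>R (A *\<^sub>R P2 v + J w (P2 v)),
      (2 * dA Y / t - 2 * A * snd (snd Y) / t\<^sup>2) *\<^sub>R z + (2 * A / t) *\<^sub>R fst (snd Y),
      2 * dA Y - 2 * (2 * A * dA Y + 2 * (w \<bullet> dw Y)) / t
        + 2 * (A\<^sup>2 + w \<bullet> w) * snd (snd Y) / t\<^sup>2))) (at (v, z, t))"
proof -
  let ?p = "(v, z, t)"
  have hA: "(height has_derivative dA) (at ?p)"
    using height_has_derivative[of ?p] by (simp add: dA_def)
  have hw: "(center has_derivative dw) (at ?p)"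
    using center_has_derivative[of ?p] by (simp add: dw_def)
  have eqs: "height ?p = A" "center ?p = w"
    by (simp_all add: A_def w_def)
  have 1: "((\<lambda>q. (2 / snd (snd q)) *\<^sub>R (height q *\<^sub>R P2 (fst q) + J (center q) (P2 (fst q))))
     has_derivative (\<lambda>Y. (2 / t) *\<^sub>R (dA Y *\<^sub>R P2 v + A *\<^sub>R P2 (fst Y) + J (dw Y) (P2 v) + J w (P2 (fst Y)))
        - (2 * snd (snd Y) / t\<^sup>2) *\<^sub>R (A *\<^sub>R P2 v + J w (P2 v)))) (at ?p)"
    by (rule derivative_eq_intros hA hw refl | (simp add: assms(1) less_imp_neq[symmetric]; fail))+
      (use assms(1) in \<open>simp add: eqs fun_eq_iff power2_eq_square algebra_simps\<close>)
  have 2: "((\<lambda>q. (2 * height q / snd (snd q)) *\<^sub>R fst (snd q)) has_derivative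
      (\<lambda>Y. (2 * dA Y / t - 2 * A * snd (snd Y) / t\<^sup>2) *\<^sub>R z + (2 * A / t) *\<^sub>R fst (snd Y))) (at ?p)"
    by (rule derivative_eq_intros hA hw refl | (simp add: assms(1) less_imp_neq[symmetric]; fail))+
      (use assms(1) in \<open>simp add: eqs fun_eq_iff power2_eq_square diff_divide_distrib\<close>)
  have 3: "((\<lambda>q. 2 * height q - 2 * ((height q)\<^sup>2 + center q \<bullet> center q) / snd (snd q)) has_derivative
      (\<lambda>Y. 2 * dA Y - 2 * (2 * A * dA Y + 2 * (w \<bullet> dw Y)) / t
        + 2 * (A\<^sup>2 + w \<bullet> w) * snd (snd Y) / t\<^sup>2)) (at ?p)"
    by (rule derivative_eq_intros hA hw refl | (simp add: assms(1) less_imp_neq[symmetric]; fail))+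
      (use assms(1) in \<open>simp add: eqs fun_eq_iff inner_commute; simp add: field_simps power2_eq_square\<close>)
  show ?thesis
    unfolding F_gradient_def[abs_def] by (intro has_derivative_Pair 1 2 3)
qed

text \<open>For a unit vector \<open>f\<close>, \<open>J f\<close> interchanges the summands, so
  \<open>P1\<close> is the conjugate \<open>- J f P2 J f\<close> of \<open>P2\<close>. The two
  projections thus have equal traces, with sum \<open>DIM('v)\<close>.\<close>

lemma trace_P2:
  assumes totally_real
  shows "(\<Sum>e\<in>Basis. P2 e \<bullet> e) = DIM('v) / 2"
proof -
  define f :: 'z where "f = (SOME b. b \<in> Basis)"
  have f: "f \<bullet> f = 1" by (simp add: f_def some_in_eq)
  have P1: "P1 e = - J f (P2 (J f e))" for e
  proof -
    have "J f (P1 e) = P2 (J f e)"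
      using assms linear_add[OF linear_J, of f "P1 e" "P2 e"]
      by (simp add: P_add totally_real_def P_simps)
    then show ?thesis using J_J[of f "P1 e"] by (simp add: f)
  qed
  have "(\<Sum>e\<in>Basis. J f (P2 (J f e)) \<bullet> e) = (\<Sum>e\<in>Basis. P2 (J f (J f e)) \<bullet> e)"
    using trace_cyclic[OF linear_compose[OF linear_J[of f] linear_P(2)] linear_J[of f]] by (simp add: o_def)
  also have "\<dots> = - (\<Sum>e\<in>Basis. P2 e \<bullet> e)"
    by (simp add: J_J f linear_neg[OF linear_P(2)] sum_negf)
  finally have "(\<Sum>e\<in>Basis. P1 e \<bullet> e) = (\<Sum>e\<in>Basis. P2 e \<bullet> e)"
    by (simp add: P1 sum_negf)
  moreover have "(\<Sum>e\<in>Basis. P1 e \<bullet> e) + (\<Sum>e\<in>Basis. P2 e \<bullet> e) = DIM('v)"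
    by (simp add: P_add flip: sum.distrib inner_add_left)
  ultimately show ?thesis by simp
qed

text \<open>As \<open>P2\<close> is idempotent, cyclicity brings a second copy of it to the front,
  where it annihilates the image of \<open>J w P2\<close> in \<open>V1\<close>.\<close>

lemma trace_J_P2:
  assumes totally_real
  shows "(\<Sum>e\<in>Basis. J w (P2 e) \<bullet> e) = 0"
proof -
  have "(\<Sum>e\<in>Basis. J w (P2 e) \<bullet> e) = (\<Sum>e\<in>Basis. P2 (J w (P2 e)) \<bullet> e)"
    using trace_cyclic[OF linear_compose[OF linear_P(2) linear_J[of w]] linear_P(2)]
    by (simp add: o_def)
  then show ?thesis
    using assms by (simp add: totally_real_def)
qed

lemma riem_laplacian_F:
  assumes tr: totally_real and p: "p \<in> half_space"
  shows "riem_laplacian (dr_metric J) F p =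
    2 * (real DIM('z) - 1) * height p / snd (snd p) + (DIM('v) + 2 * DIM('z) + 4) * F p - 2 - 2 * DIM('z)"
proof -
  obtain v z t where peq: "p = (v, z, t)" by (cases p)
  have t: "t > 0" using p by (simp add: peq half_space_def)
  define w where "w = center (v, z, t)"
  define A where "A = height (v, z, t)"
  define x where "x = P1 v"
  define y where "y = P2 v"
  define N where "N = A\<^sup>2 + w \<bullet> w"
  have mem: "x \<in> V1" "y \<in> V2"
    by (auto simp: x_def y_def)
  have yy: "y \<bullet> y = 2 * (A - t)"
    by (simp add: A_def height_def peq y_def)
  have "((riem_gradient (dr_metric J) F) has_derivative V') (at p)"
    if "(F_gradient has_derivative V') (at p)" for V'
    using that open_half_space p by (rule has_derivative_transform_within_open) (simp add: riem_gradient_F[OF tr])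
  note deriv = this[unfolded peq, OF F_gradient_has_derivative[OF t, of v z],
      folded w_def A_def x_def y_def]
  \<comment> \<open>These rewritings produce products of two brackets, the form that
    \<open>sum_bracket_inner_bracket\<close> can sum. The mixed sum over \<open>x\<close> and
    \<open>y\<close> then vanishes by orthogonality.\<close>
  have 1: "J (bracket J x u) y \<bullet> e = bracket J u x \<bullet> bracket J e y" for u e
    using bracket_swap[of x u] bracket_swap[of y e] by (simp flip: bracket_inner')
  have 2: "J (bracket J u y) y \<bullet> e = - (bracket J u y \<bullet> bracket J e y)" for u e
    using bracket_swap[of y e] by (simp flip: bracket_inner')
  have "(\<Sum>e\<in>Basis. (y \<bullet> P2 e) * (y \<bullet> e)) = y \<bullet> y"
    using mem by (simp add: euclidean_inner[of y y] flip: P_selfadjoint)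
  note yP2y = this
  have e: "((2 / t) *\<^sub>R ((y \<bullet> P2 e) *\<^sub>R y + A *\<^sub>R P2 e
      + J (- ((1/2) *\<^sub>R (bracket J x e + bracket J e y))) y + J w (P2 e))) \<bullet> e
    = (2 / t) * ((y \<bullet> P2 e) * (y \<bullet> e) + A * (P2 e \<bullet> e)
      + ((1/2) * (bracket J e y \<bullet> bracket J e y) - (1/2) * (bracket J e x \<bullet> bracket J e y))
      + J w (P2 e) \<bullet> e)" for e
    by (simp add: J_simps inner_add_left inner_diff_left 1 2)
      (simp add: diff_divide_distrib)
  have tv: "(\<Sum>e\<in>Basis. ((2 / t) *\<^sub>R ((y \<bullet> P2 e) *\<^sub>R y + A *\<^sub>R P2 e
      + J (- ((1/2) *\<^sub>R (bracket J x (P2 e) + bracket J (P1 e) y))) y + J w (P2 e))) \<bullet> e)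
      = (2 / t) * (y \<bullet> y + A * (DIM('v) / 2) + (1/2) * (DIM('z) * (y \<bullet> y)))"
    unfolding bracket_V1_P2[OF tr mem(1)] bracket_P1_V2[OF tr mem(2)]
      e sum_distrib_left[symmetric] sum.distrib sum_subtractf yP2y trace_P2[OF tr]
      trace_J_P2[OF tr] sum_bracket_inner_bracket V_inner_zero(1)[OF mem]
    by simp
  have X: "riem_gradient (dr_metric J) F (v, z, t) = F_gradient (v, z, t)"
    using riem_gradient_F[OF tr p] by (simp add: peq)
  have "riem_laplacian (dr_metric J) F p
    = (2 / t) * (y \<bullet> y + A * (DIM('v) / 2) + (1/2) * (DIM('z) * (y \<bullet> y)))
      + (DIM('z) * (2 * A / t) + (2 - 4 * A / t + 2 * N / t\<^sup>2))
      - (DIM('v) / 2 + DIM('z) + 1) * (2 * A - 2 * N / t) / t"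
    unfolding riem_laplacian_def peq riem_divergence_dr_metric[OF p[unfolded peq] deriv] X
    using tv
    by (simp add: sum_Basis_prod[where 'a = 'v] sum_Basis_prod[where 'a = 'z and 'b = real]
        zero_prod_def P_simps bracket_simps J_simps F_gradient_def A_def[symmetric]
        w_def[symmetric] N_def)
  \<comment> \<open>Substituting \<open>2 * (A - t)\<close> for \<open>y \<bullet> y\<close> leaves
    \<open>A / t\<close> as the only quantity besides \<open>N / t\<^sup>2\<close>, which is
    \<open>F\<close>.\<close>
  also have "\<dots> = 2 * (real DIM('z) - 1) * (A / t) + (DIM('v) + 2 * DIM('z) + 4) * (N / t\<^sup>2)
      - 2 - 2 * DIM('z)"
    unfolding yy using t by (simp add: field_simps power2_eq_square)
  finally show ?thesis
    by (simp add: F_eq peq N_def A_def w_def)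
qed


section \<open>The isoparametric case and complex hyperbolic space\<close>

lemma J_eq_0_iff: "J z v = 0 \<longleftrightarrow> z = 0 \<or> v = 0"
  using J_norm[of z v] by (metis mult_eq_0_iff norm_eq_zero)

text \<open>\<open>V2\<close> cannot be trivial: a nonzero vector with no component in
  \<open>V2\<close> lies in \<open>V1\<close>, and \<open>J e\<close> maps it injectively into
  \<open>V2\<close>.\<close>

lemma totally_real_nonzero:
  assumes totally_real
  obtains y where "y \<in> V2" "y \<noteq> 0"
proof -
  define v :: 'v where "v = (SOME b. b \<in> Basis)"
  define e :: 'z where "e = (SOME b. b \<in> Basis)"
  have ne: "v \<noteq> 0" "e \<noteq> 0"
    by (simp_all add: v_def e_def some_in_eq nonzero_Basis)
  show thesis
  proof (cases "P2 v = 0")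
    case False
    then show thesis using that[of "P2 v"] by simp
  next
    case True
    then have "v \<in> V1" using P_add[of v] P_in(1)[of v] by simp
    then show thesis using that[of "J e v"] ne assms by (simp add: totally_real_def J_eq_0_iff)
  qed
qed

text \<open>The height is not a function of \<open>F\<close>, so it has to drop out of the Laplacian.\<close>

lemma isoparametric_iff:
  "isoparametric half_space (dr_metric J) F \<longleftrightarrow> totally_real \<and> DIM('z) = 1"
proof (intro iffI conjI)
  assume iso: "isoparametric half_space (dr_metric J) F"
  then show tr: totally_real
    by (simp add: isoparametric_def transnormal_iff)
  obtain a where a: "\<And>p. p \<in> half_space \<Longrightarrow> riem_laplacian (dr_metric J) F p = a (F p)"
    using iso unfolding isoparametric_def by blast
  obtain y where y: "y \<in> V2" "y \<noteq> 0"
    using totally_real_nonzero[OF tr] .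
  \<comment> \<open>At this point the height is \<open>1 + (y \<bullet> y) / 2\<close>, while at the
    vertical point of the same level it is 1; in both \<open>t = 1\<close>. Equal Laplacians
    therefore force the coefficient of the height to vanish.\<close>
  let ?p = "(y, 0, 1) :: 'v \<times> 'z \<times> real"
  have p: "?p \<in> half_space"
    by (simp add: half_space_def)
  obtain z where z: "F (0, z, 1) = F ?p"
    using vertical_point[OF p] .
  have q: "(0, z, 1) \<in> half_space"
    by (simp add: half_space_def)
  have "riem_laplacian (dr_metric J) F ?p = riem_laplacian (dr_metric J) F (0, z, 1)"
    using a[OF p] a[OF q] z by simp
  then have "(real DIM('z) - 1) * (y \<bullet> y) = 0"
    unfolding riem_laplacian_F[OF tr p] riem_laplacian_F[OF tr q] z
    using y by (simp add: height_def P_simps algebra_simps)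
  then show "DIM('z) = 1"
    using y by simp
next
  assume "totally_real \<and> DIM('z) = 1"
  then have tr: totally_real and m: "DIM('z) = 1" by auto
  have "riem_laplacian (dr_metric J) F p = (DIM('v) + 6) * F p - 4" if "p \<in> half_space" for p
    using riem_laplacian_F[OF tr that] m by simp
  moreover have "continuous_on (F ` half_space) (\<lambda>s. (DIM('v) + 6) * s - 4)"
    by (intro continuous_intros)
  ultimately show "isoparametric half_space (dr_metric J) F"
    unfolding isoparametric_def transnormal_iff using tr by blast
qed

lemma dim_V1_V2: "dim V1 + dim V2 = DIM('v)"
proof -
  have "v \<in> {x + y |x y. x \<in> V1 \<and> y \<in> V2}" for v
    using V1_V2_sum[of v] by blast
  then have "{x + y |x y. x \<in> V1 \<and> y \<in> V2} = UNIV"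
    by blast
  moreover have "x = 0" if "x \<in> V1" "x \<in> V2" for x
    using V1_V2_orthogonal[OF that] by simp
  then have "V1 \<inter> V2 = {0}"
    using subspace_0[OF subspace_V1] subspace_0[OF subspace_V2] by blast
  ultimately show ?thesis
    using dim_sums_Int[OF subspace_V1 subspace_V2] by (simp add: dim_UNIV)
qed

lemma dim_J_image:
  assumes "e \<noteq> 0"
  shows "dim (J e ` V) = dim V"
proof (rule dim_image_eq[OF linear_J])
  show "inj_on (J e) (span V)"
    using assms by (intro inj_onI) (metis J_eq_0_iff J_simps(4) right_minus_eq)
qed

text \<open>Orthogonality of \<open>J e x\<close> to \<open>V1\<close> means that \<open>J e\<close>
  maps \<open>V1\<close> into \<open>V2\<close>; equal dimensions make this map onto, and its square
  is minus the identity, so it also maps \<open>V2\<close> into \<open>V1\<close>. Every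
  \<open>z\<close> is a multiple of \<open>e\<close>. Conversely, both inclusions together with
  injectivity give equal dimensions.\<close>

lemma complex_hyperbolic_iff:
  "(\<exists>k. complex_hyperbolic J k \<and> maximal_totally_real J k V1) \<longleftrightarrow> totally_real \<and> DIM('z) = 1"
proof (intro iffI conjI)
  define e :: 'z where "e = (SOME b. b \<in> Basis)"
  have e: "e \<in> Basis" "e \<noteq> 0" "norm e = 1"
    by (simp_all add: e_def some_in_eq nonzero_Basis)
  {
    assume "\<exists>k. complex_hyperbolic J k \<and> maximal_totally_real J k V1"
    then obtain k where ch: "complex_hyperbolic J k" and mtr: "maximal_totally_real J k V1"
      by blast
    show m: "DIM('z) = 1"
      using ch by (simp add: complex_hyperbolic_def)
    have "P1 (J e x) = 0" if "x \<in> V1" for x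
    proof -
      have "J e x \<bullet> P1 (J e x) = 0"
        using mtr that e unfolding maximal_totally_real_def orthogonal_def by simp
      then have "P1 (J e x) \<bullet> P1 (J e x) = 0"
        using P_selfadjoint(1)[of "J e x" "P1 (J e x)"] by simp
      then show ?thesis by simp
    qed
    then have J1: "J e x \<in> V2" if "x \<in> V1" for x
      using that P_add[of "J e x"] P_in(2)[of "J e x"] by simp
    have "DIM('v) = 2 * dim V1"
      using ch mtr by (simp add: complex_hyperbolic_def maximal_totally_real_def)
    then have "dim V2 \<le> dim (J e ` V1)"
      using dim_V1_V2 e by (simp add: dim_J_image)
    then have "J e ` V1 = V2"
      using J1 subspace_V2 linear_subspace_image[OF linear_J subspace_V1]
      by (intro subspace_dim_equal) auto
    then have J2: "J e y \<in> V1" if "y \<in> V2" for y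
      using that e by (auto simp: J_clifford subspace_neg[OF subspace_V1])
    have z: "z = (z \<bullet> e) *\<^sub>R e" for z
    proof -
      have B: "Basis = {e}"
        using m e by (metis card_1_singletonE singletonD)
      have "(\<Sum>b\<in>Basis. (z \<bullet> b) *\<^sub>R b) = (z \<bullet> e) *\<^sub>R e"
        unfolding B by simp
      then show ?thesis unfolding euclidean_representation .
    qed
    show totally_real
      unfolding totally_real_def
    proof (intro conjI allI ballI)
      fix z x assume "x \<in> V1"
      then show "J z x \<in> V2"
        using J1[of x] subspace_V2 by (subst z) (simp add: J_simps subspace_scale)
    next
      fix z y assume "y \<in> V2"
      then show "J z y \<in> V1"
        using J2[of y] subspace_V1 by (subst z) (simp add: J_simps subspace_scale)
    qed
  }
  assume "totally_real \<and> DIM('z) = 1"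
  then have tr: totally_real and m: "DIM('z) = 1" by auto
  have "dim (J e ` V1) \<le> dim V2" "dim (J e ` V2) \<le> dim V1"
    using tr by (auto intro!: dim_subset simp: totally_real_def)
  then have "dim V1 = dim V2"
    using e by (simp add: dim_J_image)
  \<comment> \<open>The witness \<open>k\<close> is dictated by
    \<open>dim V1 = k - 1\<close>.\<close>
  then have "complex_hyperbolic J (dim V1 + 1)"
    using dim_V1_V2 m by (simp add: complex_hyperbolic_def damek_ricci_axioms)
  moreover have "maximal_totally_real J (dim V1 + 1) V1"
    using tr subspace_V1
    by (simp add: maximal_totally_real_def totally_real_def orthogonal_def)
  ultimately show "\<exists>k. complex_hyperbolic J k \<and> maximal_totally_real J k V1"
    by blast
qed

end

theorem proposition6p4:
  fixes J :: "'z::euclidean_space \<Rightarrow> 'v::euclidean_space \<Rightarrow> 'v"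
    and V1 V2 :: "'v set"
  assumes "damek_ricci J"
    and "subspace V1" and "subspace V2"
    and "\<forall>x\<in>V1. \<forall>y\<in>V2. orthogonal x y"
    and "\<forall>v. \<exists>x\<in>V1. \<exists>y\<in>V2. v = x + y"
  shows "(transnormal half_space (dr_metric J) (dr_function J V1 V2) \<longleftrightarrow>
            (\<forall>z. \<forall>x\<in>V1. J z x \<in> V2) \<and> (\<forall>z. \<forall>y\<in>V2. J z y \<in> V1))
       \<and> (isoparametric half_space (dr_metric J) (dr_function J V1 V2) \<longleftrightarrow>
            (\<exists>k. complex_hyperbolic J k \<and> maximal_totally_real J k V1))"
proof -
  interpret damek_ricci J by fact
  interpret damek_ricci_decomposition J V1 V2
    using assms(2-5) by unfold_locales (auto simp: orthogonal_def)
  show ?thesis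
    unfolding isoparametric_iff complex_hyperbolic_iff transnormal_iff totally_real_def by simp
qed

end
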